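(* Let $k\ge 1$ and $g\ge 0$. The restriction to the mapping class group $\mathbf{\Gamma}_{g,1}$ of the Borel--Moore homology variant of the homological representation functor $L_k(\mathcal{F}_{(\underline{k},0,1)})$ (parameters $d=2$, $Z=\underline{k}$ a set of $k$ points, $\mathsf{G}$ the trivial group, i.e. the discrete partition of $k$, $\ell=1$, degree $i=k$) is isomorphic to the $k$-th Moriyama representation $$\mathbf{\Gamma}_{g,1}\longrightarrow\mathrm{Aut}_{\mathbb{Z}}\bigl(H_k(\Sigma_{g,1}^{\times k},\Delta\cup A_g;\mathbb{Z})\bigr).$$
   Context: $\Sigma_{g,1}$ is the compact connected orientable surface of genus $g$ with one boundary component, $p_0\in\partial\Sigma_{g,1}$ is a chosen basepoint, and $\mathbf{\Gamma}_{g,1}=\pi_0(\mathrm{Diff}_\partial(\Sigma_{g,1}))$. The functor. In the variant considered, the surface $\Sigma_{g,1}$ is replaced by $\Sigma'_{g,1}=\Sigma_{g,1}\smallsetminus\{p_0\}$ and configuration points are allowed to lie in the boundary. Since $\ell=1$, the local coefficients are trivial ($G/\Gamma_1(G)$ is the trivial group), and the $\mathbf{\Gamma}_{g,1}$-representation encoded by the functor is the natural action of $\mathbf{\Gamma}_{g,1}$ on the Borel--Moore homology group $H^{\mathrm{BM}}_k(F_k(\Sigma'_{g,1});\mathbb{Z})$, where $F_k(Y)$ denotes the ordered configuration space of $k$ distinct points in $Y$ and diffeomorphisms act diagonally. Moriyama representation. $\Delta\subset\Sigma_{g,1}^{\times k}$ is the fat diagonal (at least two of the $k$ points coincide), $A_g\subset\Sigma_{g,1}^{\times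 k}$ is the subspace where at least one of the points equals $p_0$, and $\mathbf{\Gamma}_{g,1}$ acts on $H_k(\Sigma_{g,1}^{\times k},\Delta\cup A_g;\mathbb{Z})$ via the diagonal action. *)

theory Defs
  imports "HOL-Analysis.Analysis" "HOL-Homology.Homology" "HOL-Algebra.Bij"
begin

section \<open>Smooth maps between subsets of Euclidean spaces\<close>

text \<open>\<open>Ck_on n f U\<close> is meant for open \<open>U\<close> only.\<close>

primrec Ck_on ::
  "nat \<Rightarrow> ('a::euclidean_space \<Rightarrow> 'b::euclidean_space) \<Rightarrow> 'a set \<Rightarrow> bool" where
  "Ck_on 0 f U \<longleftrightarrow> continuous_on U f"
| "Ck_on (Suc n) f U \<longleftrightarrow>
     (\<forall>x\<in>U. f differentiable at x) \<and>
     (\<forall>v. Ck_on n (\<lambda>x. frechet_derivative f (at x) v) U)"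

text \<open>On an arbitrary subset, smooth means: locally the restriction of a \<open>C\<^sup>\<infinity>\<close> map defined on an
  open subset of the ambient space.\<close>

definition smooth_on :: "'a set \<Rightarrow> ('a::euclidean_space \<Rightarrow> 'b::euclidean_space) \<Rightarrow> bool" where
  "smooth_on S f \<longleftrightarrow>
     (\<forall>x\<in>S. \<exists>U F. open U \<and> x \<in> U \<and> (\<forall>n. Ck_on n F U) \<and> (\<forall>y\<in>S \<inter> U. F y = f y))"

definition diffeo ::
  "'a set \<Rightarrow> 'b set \<Rightarrow> ('a::euclidean_space \<Rightarrow> 'b::euclidean_space) \<Rightarrow> bool" where
  "diffeo S T f \<longleftrightarrow> bij_betw f S T \<and> smooth_on S f \<and> smooth_on T (inv_into S f)"


section \<open>Smooth surfaces with boundary\<close>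

definition half_plane :: "(real^2) set" where
  "half_plane = {p. 0 \<le> p $ 2}"

text \<open>A chart is given by its inverse, a local parametrisation \<open>\<phi>\<close> defined on a relatively open
  subset \<open>W\<close> of the half-plane.\<close>

definition chart :: "('a::euclidean_space) set \<Rightarrow> (real^2) set \<Rightarrow> (real^2 \<Rightarrow> 'a) \<Rightarrow> bool" where
  "chart M W \<phi> \<longleftrightarrow>
     openin (top_of_set half_plane) W \<and> openin (top_of_set M) (\<phi> ` W) \<and> diffeo W (\<phi> ` W) \<phi>"

definition smooth_surface :: "('a::euclidean_space) set \<Rightarrow> bool" where
  "smooth_surface M \<longleftrightarrow> (\<forall>x\<in>M. \<exists>W \<phi>. chart M W \<phi> \<and> x \<in> \<phi> ` W)"

definition bdry :: "('a::euclidean_space) set \<Rightarrow> 'a set" where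
  "bdry M = {x. \<exists>W \<phi> p. chart M W \<phi> \<and> p \<in> W \<and> p $ 2 = 0 \<and> x = \<phi> p}"

text \<open>Derivatives are taken within the half-plane, where they are unique also at boundary points.\<close>

definition orientable :: "('a::euclidean_space) set \<Rightarrow> bool" where
  "orientable M \<longleftrightarrow>
     (\<exists>\<A>. (\<forall>(W, \<phi>)\<in>\<A>. chart M W \<phi>) \<and> M = (\<Union>(W, \<phi>)\<in>\<A>. \<phi> ` W) \<and>
        (\<forall>(W, \<phi>)\<in>\<A>. \<forall>(V, \<psi>)\<in>\<A>. \<forall>p\<in>W. \<phi> p \<in> \<psi> ` V \<longrightarrow>
           0 < det (matrix (frechet_derivative (inv_into V \<psi> \<circ> \<phi>) (at p within half_plane)))))"

text \<open>The genus of a connected orientable surface is the maximal number of pairwise disjoint simple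
  closed curves in its interior whose union does not disconnect it.\<close>

definition nonseparating_system :: "('a::euclidean_space) set \<Rightarrow> 'a set set \<Rightarrow> bool" where
  "nonseparating_system M \<C> \<longleftrightarrow>
     finite \<C> \<and> pairwise disjnt \<C> \<and>
     (\<forall>C\<in>\<C>. C \<subseteq> M - bdry M \<and>
        (\<exists>c. simple_path c \<and> pathfinish c = pathstart c \<and> C = path_image c)) \<and>
     connected (M - \<Union>\<C>)"

definition has_genus :: "('a::euclidean_space) set \<Rightarrow> nat \<Rightarrow> bool" where
  "has_genus M g \<longleftrightarrow>
     (\<exists>\<C>. nonseparating_system M \<C> \<and> card \<C> = g) \<and>
     (\<forall>\<C>. nonseparating_system M \<C> \<longrightarrow> card \<C> \<le> g)"

definition is_Sigma_g1 :: "nat \<Rightarrow> ('a::euclidean_space) set \<Rightarrow> bool" where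
  "is_Sigma_g1 g M \<longleftrightarrow>
     smooth_surface M \<and> compact M \<and> connected M \<and> orientable M \<and>
     has_genus M g \<and> card (components (bdry M)) = 1"


section \<open>The mapping class group\<close>

text \<open>Diffeomorphisms fixing the boundary pointwise, normalised to be \<open>undefined\<close> off \<open>M\<close>.\<close>

definition Diff_bdry :: "('a::euclidean_space) set \<Rightarrow> ('a \<Rightarrow> 'a) monoid" where
  "Diff_bdry M = BijGroup M
     \<lparr>carrier := {f \<in> Bij M. diffeo M M f \<and> (\<forall>x\<in>bdry M. f x = x)}\<rparr>"

primrec deriv_along ::
  "(real^2) list \<Rightarrow> (real^2 \<Rightarrow> 'b::euclidean_space) \<Rightarrow> real^2 \<Rightarrow> 'b" where
  "deriv_along [] F = F"
| "deriv_along (v # vs) F =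
     (\<lambda>p. frechet_derivative (deriv_along vs F) (at p within half_plane) v)"

text \<open>The \<open>C\<^sup>\<infinity>\<close> topology: uniform convergence, on compact subsets of charts, of all iterated
  partial derivatives of the maps regarded as maps into the ambient Euclidean space.\<close>

definition Cinf_topology :: "('a::euclidean_space) set \<Rightarrow> ('a \<Rightarrow> 'a) topology" where
  "Cinf_topology M = topology_generated_by
     {{h \<in> carrier (Diff_bdry M).
         \<forall>p\<in>K. norm (deriv_along vs (h \<circ> \<phi>) p - deriv_along vs (f \<circ> \<phi>) p) < \<epsilon>}
       | f W \<phi> K vs \<epsilon>.
         f \<in> carrier (Diff_bdry M) \<and> chart M W \<phi> \<and> compact K \<and> K \<subseteq> W \<and> 0 < \<epsilon>}"

text \<open>\<open>\<pi>\<^sub>0\<close> of the topological group \<open>Diff_bdry M\<close>; in a topological group the product of the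
  path components of \<open>f\<close> and \<open>h\<close> is their elementwise product.\<close>

definition mapping_class_group :: "('a::euclidean_space) set \<Rightarrow> ('a \<Rightarrow> 'a) set monoid" where
  "mapping_class_group M =
     \<lparr>carrier = path_components_of (Cinf_topology M),
      mult = set_mult (Diff_bdry M),
      one = path_component_of_set (Cinf_topology M) \<one>\<^bsub>Diff_bdry M\<^esub>\<rparr>"


section \<open>Borel--Moore homology\<close>

text \<open>Borel--Moore homology (with integer coefficients) of a locally compact Hausdorff space, as the
  homology of the complex of locally finite singular chains.\<close>

type_synonym 'a lf_chain = "((nat \<Rightarrow> real) \<Rightarrow> 'a) \<Rightarrow> int"

definition lf_chain :: "nat \<Rightarrow> 'a topology \<Rightarrow> 'a lf_chain \<Rightarrow> bool" where
  "lf_chain p X c \<longleftrightarrow>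
     (\<forall>\<sigma>. c \<sigma> \<noteq> 0 \<longrightarrow> singular_simplex p X \<sigma>) \<and>
     (\<forall>K. compactin X K \<longrightarrow> finite {\<sigma>. c \<sigma> \<noteq> 0 \<and> \<sigma> ` standard_simplex p \<inter> K \<noteq> {}})"

text \<open>Extension of a chain-valued map on simplices to infinite chains. In the two uses below the
  sum is finite: each \<open>\<sigma>\<close> in it meets the compact set \<open>\<tau> ` standard_simplex _\<close>, or, for a
  proper map, the preimage of that set.\<close>

definition lf_extend ::
  "(((nat \<Rightarrow> real) \<Rightarrow> 'a) \<Rightarrow> 'b chain) \<Rightarrow> 'a lf_chain \<Rightarrow> 'b lf_chain" where
  "lf_extend F c = (\<lambda>\<tau>. \<Sum>\<sigma> | c \<sigma> \<noteq> 0 \<and> \<tau> \<in> Poly_Mapping.keys (F \<sigma>).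
     c \<sigma> * Poly_Mapping.lookup (F \<sigma>) \<tau>)"

definition lf_boundary :: "nat \<Rightarrow> 'a lf_chain \<Rightarrow> 'a lf_chain" where
  "lf_boundary p = lf_extend (\<lambda>\<sigma>. chain_boundary p (frag_of \<sigma>))"

definition lf_chain_map :: "nat \<Rightarrow> ('a \<Rightarrow> 'b) \<Rightarrow> 'a lf_chain \<Rightarrow> 'b lf_chain" where
  "lf_chain_map p f = lf_extend (\<lambda>\<sigma>. chain_map p f (frag_of \<sigma>))"

definition lf_cycle_group :: "nat \<Rightarrow> 'a topology \<Rightarrow> 'a lf_chain monoid" where
  "lf_cycle_group p X =
     \<lparr>carrier = {c. lf_chain p X c \<and> lf_boundary p c = (\<lambda>_. 0)},
      mult = (\<lambda>c d \<sigma>. c \<sigma> + d \<sigma>),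
      one = (\<lambda>_. 0)\<rparr>"

definition lf_boundary_set :: "nat \<Rightarrow> 'a topology \<Rightarrow> 'a lf_chain set" where
  "lf_boundary_set p X = lf_boundary (Suc p) ` Collect (lf_chain (Suc p) X)"

definition BM_homology_group :: "nat \<Rightarrow> 'a topology \<Rightarrow> 'a lf_chain set monoid" where
  "BM_homology_group p X = lf_cycle_group p X Mod lf_boundary_set p X"

text \<open>The map induced by a proper continuous map \<open>f : X \<rightarrow> Y\<close> sends the class \<open>c + B(X)\<close> to
  \<open>f\<^sub>*(c) + B(Y)\<close>.\<close>

definition BM_induced ::
  "nat \<Rightarrow> 'b topology \<Rightarrow> ('a \<Rightarrow> 'b) \<Rightarrow> 'a lf_chain set \<Rightarrow> 'b lf_chain set" where
  "BM_induced p Y f z = lf_boundary_set p Y <#>\<^bsub>lf_cycle_group p Y\<^esub> lf_chain_map p f ` z"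


section \<open>Configuration spaces and the two representations\<close>

text \<open>The \<open>k\<close> points are labelled by a finite type \<open>'k\<close> with \<open>k = CARD('k)\<close>, which is at
  least 1. The homological degree is \<open>CARD('k)\<close> as well.\<close>

definition cart_power :: "'a set \<Rightarrow> ('a^'k) set" where
  "cart_power S = {x. \<forall>i. x $ i \<in> S}"

definition fat_diagonal :: "'a set \<Rightarrow> ('a^'k) set" where
  "fat_diagonal S = {x \<in> cart_power S. \<exists>i j. i \<noteq> j \<and> x $ i = x $ j}"

definition basepoint_locus :: "'a set \<Rightarrow> 'a \<Rightarrow> ('a^'k) set" where
  "basepoint_locus S p0 = {x \<in> cart_power S. \<exists>i. x $ i = p0}"

definition config_space :: "'a set \<Rightarrow> ('a^'k) set" where
  "config_space Y = {x \<in> cart_power Y. \<forall>i j. i \<noteq> j \<longrightarrow> x $ i \<noteq> x $ j}"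

definition diagonal_map :: "('a \<Rightarrow> 'b) \<Rightarrow> 'a^'k \<Rightarrow> 'b^'k" where
  "diagonal_map f x = (\<chi> i. f (x $ i))"

definition BM_module ::
  "('a::euclidean_space) set \<Rightarrow> 'a \<Rightarrow> ('a^'k::finite) lf_chain set monoid" where
  "BM_module M p0 = BM_homology_group CARD('k) (top_of_set (config_space (M - {p0})))"

definition BM_action ::
  "('a::euclidean_space) set \<Rightarrow> 'a \<Rightarrow> ('a \<Rightarrow> 'a) \<Rightarrow>
   ('a^'k::finite) lf_chain set \<Rightarrow> ('a^'k) lf_chain set" where
  "BM_action M p0 f = restrict
     (BM_induced CARD('k) (top_of_set (config_space (M - {p0}))) (diagonal_map f))
     (carrier (BM_module M p0))"

definition Moriyama_module ::
  "('a::euclidean_space) set \<Rightarrow> 'a \<Rightarrow> ('a^'k::finite) chain set monoid" where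
  "Moriyama_module M p0 = relative_homology_group (int CARD('k))
     (top_of_set (cart_power M)) (fat_diagonal M \<union> basepoint_locus M p0)"

definition Moriyama_action ::
  "('a::euclidean_space) set \<Rightarrow> 'a \<Rightarrow> ('a \<Rightarrow> 'a) \<Rightarrow>
   ('a^'k::finite) chain set \<Rightarrow> ('a^'k) chain set" where
  "Moriyama_action M p0 f = restrict
     (hom_induced (int CARD('k))
        (top_of_set (cart_power M)) (fat_diagonal M \<union> basepoint_locus M p0)
        (top_of_set (cart_power M)) (fat_diagonal M \<union> basepoint_locus M p0)
        (diagonal_map f))
     (carrier (Moriyama_module M p0))"

text \<open>\<open>\<rho>\<close> is the representation of the mapping class group on \<open>A\<close> obtained from an action \<open>act\<close> of
  diffeomorphisms that only depends on mapping classes.\<close>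

definition mcg_representation ::
  "('a::euclidean_space) set \<Rightarrow> ('b, 'c) monoid_scheme \<Rightarrow> (('a \<Rightarrow> 'a) \<Rightarrow> 'b \<Rightarrow> 'b) \<Rightarrow>
   (('a \<Rightarrow> 'a) set \<Rightarrow> 'b \<Rightarrow> 'b) \<Rightarrow> bool" where
  "mcg_representation M A act \<rho> \<longleftrightarrow>
     comm_group A \<and>
     \<rho> \<in> hom (mapping_class_group M) (AutoGroup A) \<and>
     (\<forall>\<gamma>\<in>carrier (mapping_class_group M). \<forall>f\<in>\<gamma>. \<rho> \<gamma> = act f)"

definition isomorphic_representations ::
  "('g, 'h) monoid_scheme \<Rightarrow> ('b, 'c) monoid_scheme \<Rightarrow> ('g \<Rightarrow> 'b \<Rightarrow> 'b) \<Rightarrow>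
   ('d, 'e) monoid_scheme \<Rightarrow> ('g \<Rightarrow> 'd \<Rightarrow> 'd) \<Rightarrow> bool" where
  "isomorphic_representations G A \<rho> B \<rho>' \<longleftrightarrow>
     (\<exists>\<Phi>\<in>iso A B. \<forall>\<gamma>\<in>carrier G. \<forall>x\<in>carrier A. \<Phi> (\<rho> \<gamma> x) = \<rho>' \<gamma> (\<Phi> x))"

end

theory Submission
  imports Defs
begin

text \<open>
Write \<open>X = \<Sigma>\<^sup>k\<close>, let \<open>A\<close> be the union of the fat diagonal and the locus where some point is the
basepoint, and let \<open>U = X - A\<close>, the configuration space of the punctured surface. The theorem says
that Borel--Moore homology of \<open>U\<close> is the homology of the pair \<open>(X, A)\<close>, compatibly with
diffeomorphisms. Since \<open>X\<close> is a compactification of \<open>U\<close>, both sides should be the inverse limit of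
the groups \<open>H\<^sub>p(X, X - L)\<close> over the compact sets \<open>L \<subseteq> U\<close>, and the proof makes this precise at the
level of chains.

A relative cycle \<open>\<zeta>\<close> of \<open>(X, A)\<close> is declared related to a locally finite cycle \<open>w\<close> of \<open>U\<close>
(\<open>BM_related\<close>) if for every compact \<open>L \<subseteq> U\<close> it is homologous in \<open>(X, X - L)\<close> to a finite chain
that has the same coefficients as \<open>w\<close> on all simplices meeting \<open>L\<close>. This relation is additive, and
it is preserved by every homeomorphism of the pair, because nothing was chosen. It remains to see that
it is the graph of an isomorphism on homology: each class on one side is related to exactly one class
on the other (\<open>comparison_iso\<close>, \<open>comparison_natural\<close>).

From \<open>w\<close> to \<open>\<zeta>\<close> and for uniqueness one needs to get from neighbourhoods of \<open>A\<close> to \<open>A\<close> itself. This is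
possible if \<open>U\<close> has an exhaustion by compact sets \<open>K n\<close> such that \<open>X\<close> can be deformed, within the
complement of \<open>K n\<close>, so that the complement of \<open>K (n + 1)\<close> ends up in \<open>A\<close> and \<open>A\<close> never leaves \<open>A\<close>
(locale \<open>tame_pair\<close>). Then the inverse system \<open>H\<^sub>p(X, X - K n)\<close> is isomorphic, as a pro-object, to the
constant system \<open>H\<^sub>p(X, A)\<close>; in particular the obstruction of type \<open>lim\<^sup>1\<close> to the injectivity of
\<open>H\<^sub>p\<^sup>B\<^sup>M(U) \<rightarrow> lim H\<^sub>p(X, X - K n)\<close> disappears. Conversely, excision replaces \<open>\<zeta>\<close> by chains \<open>c n\<close> in \<open>U\<close> that
differ by boundaries and by chains missing \<open>K n\<close>; summing the latter gives a locally finite chain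
(\<open>series_lf_chain\<close>).

Such deformations exist if \<open>X\<close> and \<open>A\<close> are compact absolute neighbourhood retracts
(\<open>neighbourhood_squeeze\<close>): a retraction of a neighbourhood onto \<open>A\<close> is homotopic to the identity on a
smaller neighbourhood, because this homotopy is the solution of an extension problem. A compact
surface is a finite union of open sets homeomorphic to open subsets of a half-plane, hence an absolute
neighbourhood retract by Hanner's theorem (\<open>ANR_openin_Un\<close>), and so is its power \<open>X\<close>. The set \<open>A\<close> is
a finite union of closed strata, all of whose intersections are again strata and retracts of \<open>X\<close>.

Finally, a path in the diffeomorphism group is a homotopy of maps of pairs on configurations, since
the \<open>C\<^sup>\<infinity>\<close> topology is finer than the topology of uniform convergence. Hence the action on
\<open>H\<^sub>k(X, A)\<close> depends on the mapping class only, and by the natural isomorphism the same holds for the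
action on Borel--Moore homology.
\<close>

section \<open>Unions of absolute neighbourhood retracts\<close>

text \<open>Hanner's theorem. To extend \<open>f : C \<rightarrow> S \<union> T\<close> over a neighbourhood of \<open>C\<close> in \<open>U\<close>, separate the points
  that are not mapped into \<open>T\<close> from those that are not mapped into \<open>S\<close> by open sets \<open>O1\<close> and \<open>O2\<close>. On the
  closed set \<open>U0\<close> between them extend into \<open>S \<inter> T\<close> first; then extend on the side of \<open>O1\<close> into \<open>S\<close> and
  on the side of \<open>O2\<close> into \<open>T\<close>, both times keeping the values near \<open>C\<close> in \<open>U0\<close>, and glue.\<close>

lemma ANR_openin_Un:
  fixes S T :: "'a::euclidean_space set"
  assumes opS: "openin (top_of_set (S \<union> T)) S" and opT: "openin (top_of_set (S \<union> T)) T"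
    and S: "ANR S" and T: "ANR T"
  shows "ANR (S \<union> T)"
proof (rule absolute_neighbourhood_extensor_imp_ANR)
  fix f :: "'a \<times> real \<Rightarrow> 'a" and U C
  assume contf: "continuous_on C f" and fim: "f \<in> C \<rightarrow> S \<union> T" and clo: "closedin (top_of_set U) C"
  have "C \<subseteq> U" using clo closedin_imp_subset by blast
  define C1 where "C1 = C - f -` T"
  define C2 where "C2 = C - f -` S"
  have compl: "closedin (top_of_set Q) (Q - R)" if "openin (top_of_set Q) R" for Q R :: "('a \<times> real) set"
    using that by (metis closedin_diff closedin_topspace topspace_euclidean_subtopology)
  have "C1 = C - (C \<inter> f -` T)" "C2 = C - (C \<inter> f -` S)"
    by (auto simp: C1_def C2_def)
  then have "closedin (top_of_set C) C1" "closedin (top_of_set C) C2"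
    using continuous_openin_preimage[OF contf fim opT] continuous_openin_preimage[OF contf fim opS]
    by (simp_all add: compl)
  then have cloC: "closedin (top_of_set U) C1" "closedin (top_of_set U) C2"
    using clo closedin_trans by blast+
  have "C1 \<inter> C2 = {}"
    using fim by (auto simp: C1_def C2_def)
  then obtain O1 O2 where O: "openin (top_of_set U) O1" "openin (top_of_set U) O2"
      "C1 \<subseteq> O1" "C2 \<subseteq> O2" "O1 \<inter> O2 = {}"
    using separation_normal_local[OF cloC] by metis
  define U0 where "U0 = U - (O1 \<union> O2)"
  define U1 where "U1 = U - O2"
  define U2 where "U2 = U - O1"
  have U12: "U1 \<inter> U2 = U0" "U1 \<union> U2 = U" "U0 \<subseteq> U1" "U0 \<subseteq> U2"
    using O by (auto simp: U0_def U1_def U2_def)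
  have cloU: "closedin (top_of_set U) U0" "closedin (top_of_set U) U1" "closedin (top_of_set U) U2"
    using O unfolding U0_def U1_def U2_def by (auto intro!: compl)
  have f1: "f x \<in> S" if "x \<in> C" "x \<in> U1" for x
    using that O by (auto simp: C2_def U1_def)
  have f2: "f x \<in> T" if "x \<in> C" "x \<in> U2" for x
    using that O by (auto simp: C1_def U2_def)
  have "openin (top_of_set S) (S \<inter> T)"
    using opT by (auto simp: openin_open)
  then have ST: "ANR (S \<inter> T)"
    using S ANR_openin by blast
  have cloC0: "closedin (top_of_set U0) (C \<inter> U0)"
    by (rule closedin_closed_subset[OF clo]) (auto simp: U0_def)
  have "f \<in> C \<inter> U0 \<rightarrow> S \<inter> T"
    using f1 f2 U12 by blast
  then obtain V0 f0 where V0: "C \<inter> U0 \<subseteq> V0" "openin (top_of_set U0) V0" "continuous_on V0 f0"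
      "f0 \<in> V0 \<rightarrow> S \<inter> T" "\<And>x. x \<in> C \<inter> U0 \<Longrightarrow> f0 x = f x"
    by (rule ANR_imp_absolute_neighbourhood_extensor[OF ST continuous_on_subset[OF contf inf_le1] _ cloC0]) blast
  have "closedin (top_of_set U0) (U0 - V0)"
    using V0(2) by (rule compl)
  moreover have "(C \<inter> U0) \<inter> (U0 - V0) = {}"
    using V0(1) by blast
  ultimately obtain W0 W1 where W: "openin (top_of_set U0) W0" "openin (top_of_set U0) W1"
      "C \<inter> U0 \<subseteq> W0" "U0 - V0 \<subseteq> W1" "W0 \<inter> W1 = {}"
    by (rule separation_normal_local[OF cloC0])
  define N0 where "N0 = U0 - W1"
  have N0: "W0 \<subseteq> N0" "N0 \<subseteq> V0" "N0 \<subseteq> U0"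
    using W openin_imp_subset[OF W(1)] by (auto simp: N0_def)
  have "closedin (top_of_set U0) N0"
    using W(2) unfolding N0_def by (rule compl)
  then have cloN0: "closedin (top_of_set U) N0"
    using cloU(1) closedin_trans by blast
  define f' where "f' x = (if x \<in> C then f x else f0 x)" for x
  have cont': "continuous_on (C \<union> N0) f'"
    unfolding f'_def
  proof (rule continuous_on_cases_local[OF _ _ contf])
    show "closedin (top_of_set (C \<union> N0)) C" "closedin (top_of_set (C \<union> N0)) N0"
      using closedin_subset_trans[OF clo] closedin_subset_trans[OF cloN0] \<open>C \<subseteq> U\<close> N0 cloU(1)
      by (auto dest: closedin_imp_subset)
    show "continuous_on N0 f0"
      using V0(3) N0(2) continuous_on_subset by blast
    show "\<And>x. x \<in> C \<and> x \<notin> C \<or> x \<in> N0 \<and> x \<in> C \<Longrightarrow> f x = f0 x"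
      using V0(5) N0 by auto
  qed
  have cloCN: "closedin (top_of_set U) (C \<union> N0)"
    using clo cloN0 by (rule closedin_Un)
  have clo1: "closedin (top_of_set U1) ((C \<union> N0) \<inter> U1)" and clo2: "closedin (top_of_set U2) ((C \<union> N0) \<inter> U2)"
    using U12(2) by (auto intro!: closedin_closed_subset[OF cloCN])
  have im1: "f' \<in> (C \<union> N0) \<inter> U1 \<rightarrow> S" and im2: "f' \<in> (C \<union> N0) \<inter> U2 \<rightarrow> T"
    using f1 f2 V0(4) N0 by (auto simp: f'_def)
  obtain V1 g1 where V1: "(C \<union> N0) \<inter> U1 \<subseteq> V1" "openin (top_of_set U1) V1" "continuous_on V1 g1"
      "g1 \<in> V1 \<rightarrow> S" "\<And>x. x \<in> (C \<union> N0) \<inter> U1 \<Longrightarrow> g1 x = f' x"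
    by (rule ANR_imp_absolute_neighbourhood_extensor[OF S continuous_on_subset[OF cont' inf_le1] im1 clo1]) blast
  obtain V2 g2 where V2: "(C \<union> N0) \<inter> U2 \<subseteq> V2" "openin (top_of_set U2) V2" "continuous_on V2 g2"
      "g2 \<in> V2 \<rightarrow> T" "\<And>x. x \<in> (C \<union> N0) \<inter> U2 \<Longrightarrow> g2 x = f' x"
    by (rule ANR_imp_absolute_neighbourhood_extensor[OF T continuous_on_subset[OF cont' inf_le1] im2 clo2]) blast
  have cloE: "closedin (top_of_set U) (U1 - V1)" "closedin (top_of_set U) (U2 - V2)"
      "closedin (top_of_set U) (U0 - W0)"
    by (rule closedin_trans[OF compl]; fact)+
  \<comment> \<open>The points of \<open>U0\<close> that remain lie in \<open>N0\<close>, where both extensions are equal to \<open>f'\<close>.\<close>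
  define V where "V = U - ((U1 - V1) \<union> (U2 - V2) \<union> (U0 - W0))"
  have "openin (top_of_set U) V"
    unfolding V_def by (intro openin_diff openin_subtopology_self closedin_Un cloE)
  moreover have "C \<subseteq> V"
    using \<open>C \<subseteq> U\<close> V1(1) V2(1) W(3) by (auto simp: V_def)
  ultimately have V: "openin (top_of_set U) V" "C \<subseteq> V" .
  have VU: "V \<inter> U1 \<subseteq> V1" "V \<inter> U2 \<subseteq> V2" "V \<inter> U0 \<subseteq> N0" "V \<inter> U1 \<union> V \<inter> U2 = V" "V \<subseteq> U"
    using U12 N0(1) by (auto simp: V_def)
  define g where "g x = (if x \<in> U1 then g1 x else g2 x)" for x
  have agree: "g1 x = g2 x" if "x \<in> V" "x \<in> U1" "x \<in> U2" for x
  proof -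
    have "x \<in> N0" using VU(3) U12(1) that by blast
    then show ?thesis using V1(5)[of x] V2(5)[of x] that by auto
  qed
  have "continuous_on (V \<inter> U1 \<union> V \<inter> U2) g"
    unfolding g_def
  proof (rule continuous_on_cases_local)
    show "closedin (top_of_set (V \<inter> U1 \<union> V \<inter> U2)) (V \<inter> U1)"
      "closedin (top_of_set (V \<inter> U1 \<union> V \<inter> U2)) (V \<inter> U2)"
      unfolding VU(4)
      by (rule closedin_closed_subset[OF cloU(2) VU(5)], blast,
          rule closedin_closed_subset[OF cloU(3) VU(5)], blast)
    show "continuous_on (V \<inter> U1) g1" "continuous_on (V \<inter> U2) g2"
      using V1(3) V2(3) VU continuous_on_subset by blast+
    show "\<And>x. x \<in> V \<inter> U1 \<and> x \<notin> U1 \<or> x \<in> V \<inter> U2 \<and> x \<in> U1 \<Longrightarrow> g1 x = g2 x"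
      using agree by auto
  qed
  then have "continuous_on V g"
    by (simp only: VU(4))
  moreover have "g \<in> V \<rightarrow> S \<union> T"
    using V1(4) V2(4) VU by (fastforce simp: g_def)
  moreover have "g x = f x" if "x \<in> C" for x
  proof (cases "x \<in> U1")
    case True
    then show ?thesis using V1(5)[of x] that by (simp add: g_def f'_def)
  next
    case False
    then have "x \<in> U2" using \<open>C \<subseteq> U\<close> U12(2) that by blast
    then show ?thesis using V2(5)[of x] that False by (simp add: g_def f'_def)
  qed
  ultimately show "\<exists>V g. C \<subseteq> V \<and> openin (top_of_set U) V \<and> continuous_on V g \<and> g \<in> V \<rightarrow> S \<union> T \<and>
      (\<forall>x\<in>C. g x = f x)"
    using V by blast
qed

lemma ANR_finite_Union_openin:
  fixes X :: "'a::euclidean_space set"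
  assumes "finite \<F>" "\<And>S. S \<in> \<F> \<Longrightarrow> openin (top_of_set X) S" "\<And>S. S \<in> \<F> \<Longrightarrow> ANR S"
  shows "ANR (\<Union>\<F>)"
  using assms
proof (induction \<F>)
  case (insert S \<F>)
  have op: "openin (top_of_set X) S" "openin (top_of_set X) (\<Union>\<F>)"
    using insert.prems by (auto intro: openin_Union)
  have "S \<union> \<Union>\<F> \<subseteq> X"
    using op openin_imp_subset by blast
  then have "ANR (S \<union> \<Union>\<F>)"
    using openin_subset_trans[OF op(1)] openin_subset_trans[OF op(2)] insert
    by (intro ANR_openin_Un) auto
  then show ?case by simp
qed simp

text \<open>Inclusion-exclusion: in the induction step the new set meets the union of the others in the union
  of the pairwise intersections, which satisfies the same hypotheses.\<close>

lemma ANR_finite_UN_closed: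
  fixes S :: "'i \<Rightarrow> 'a::euclidean_space set"
  assumes "finite I" "\<And>i. i \<in> I \<Longrightarrow> closed (S i)"
    and "\<And>J. \<lbrakk>J \<noteq> {}; J \<subseteq> I\<rbrakk> \<Longrightarrow> ANR (\<Inter>i\<in>J. S i)"
  shows "ANR (\<Union>i\<in>I. S i)"
  using assms
proof (induction I arbitrary: S)
  case (insert i I)
  have "ANR (S i \<union> (\<Union>j\<in>I. S j))"
  proof (rule ANR_closed_Un)
    show "closed (S i)" "closed (\<Union>j\<in>I. S j)"
      using insert.hyps insert.prems by auto
    show "ANR (S i)"
      using insert.prems(2)[of "{i}"] by simp
    show "ANR (\<Union>j\<in>I. S j)"
      using insert.prems by (intro insert.IH) auto
    have "ANR (\<Union>j\<in>I. S i \<inter> S j)"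
    proof (rule insert.IH)
      show "closed (S i \<inter> S j)" if "j \<in> I" for j
        using insert.prems that by auto
      show "ANR (\<Inter>j\<in>J. S i \<inter> S j)" if "J \<noteq> {}" "J \<subseteq> I" for J
      proof -
        have "(\<Inter>j\<in>J. S i \<inter> S j) = (\<Inter>j\<in>insert i J. S j)"
          using that(1) by auto
        then show ?thesis
          using insert.prems(2)[of "insert i J"] that by auto
      qed
    qed
    then show "ANR (S i \<inter> (\<Union>j\<in>I. S j))"
      by (simp only: Int_UN_distrib)
  qed
  then show ?case by simp
qed simp

section \<open>Compact surfaces and their configuration loci are absolute neighbourhood retracts\<close>

lemma smooth_on_imp_continuous_on:
  assumes "smooth_on S f"
  shows "continuous_on S f"
  unfolding continuous_on_eq_continuous_within
proof
  fix x assume "x \<in> S"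
  then obtain U F where U: "open U" "x \<in> U" "\<forall>n. Ck_on n F U" "\<forall>y\<in>S \<inter> U. F y = f y"
    using assms unfolding smooth_on_def by metis
  then have "continuous_on U F"
    using Ck_on.simps(1) by blast
  then have "continuous (at x within S) F"
    using U(1,2) continuous_on_eq_continuous_at continuous_at_imp_continuous_at_within by blast
  then have "(F \<longlongrightarrow> f x) (at x within S)"
    using U(2,4) \<open>x \<in> S\<close> by (simp add: continuous_within)
  moreover have "eventually (\<lambda>y. F y = f y) (at x within S)"
    using U eventually_at_topological by blast
  ultimately show "continuous (at x within S) f"
    unfolding continuous_within by (rule Lim_transform_eventually)
qed

lemma diffeo_imp_homeomorphism:
  assumes "diffeo S T f"
  shows "homeomorphism S T f (inv_into S f)"
proof (rule homeomorphismI)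
  have bij: "bij_betw f S T"
    using assms by (simp add: diffeo_def)
  show "continuous_on S f" "continuous_on T (inv_into S f)"
    using assms smooth_on_imp_continuous_on by (auto simp: diffeo_def)
  show "f ` S \<subseteq> T" "inv_into S f ` T \<subseteq> S"
    using bij bij_betw_inv_into[OF bij] by (auto simp: bij_betw_def)
  show "\<And>x. x \<in> S \<Longrightarrow> inv_into S f (f x) = x" "\<And>y. y \<in> T \<Longrightarrow> f (inv_into S f y) = y"
    using bij by (auto simp: bij_betw_inv_into_left bij_betw_inv_into_right)
qed

lemma chart_imp_homeomorphism:
  assumes "chart M W \<phi>"
  shows "homeomorphism W (\<phi> ` W) \<phi> (inv_into W \<phi>)"
  using assms diffeo_imp_homeomorphism by (auto simp: chart_def)

lemma compact_surface_imp_ANR: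
  assumes "smooth_surface M" "compact M"
  shows "ANR M"
proof -
  define \<C> where "\<C> = {\<phi> ` W |W \<phi>. chart M W \<phi>}"
  have op: "openin (top_of_set M) S" if "S \<in> \<C>" for S
    using that by (auto simp: \<C>_def chart_def)
  have cover: "M \<subseteq> \<Union>\<C>"
  proof
    fix x assume "x \<in> M"
    then obtain W \<phi> where "chart M W \<phi>" "x \<in> \<phi> ` W"
      using assms(1) by (auto simp: smooth_surface_def)
    then show "x \<in> \<Union>\<C>"
      unfolding \<C>_def by blast
  qed
  obtain \<F> where \<F>: "\<F> \<subseteq> \<C>" "finite \<F>" "M \<subseteq> \<Union>\<F>"
    using assms(2) op cover unfolding compact_eq_openin_cover by meson
  have anr: "ANR S" if S: "S \<in> \<C>" for S
  proof -
    obtain W \<phi> where W: "S = \<phi> ` W" "chart M W \<phi>"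
      using S by (auto simp: \<C>_def)
    have "convex half_plane"
      unfolding half_plane_def by (simp add: convex_def)
    then have "ANR W"
      using W(2) convex_imp_ANR ANR_openin by (auto simp: chart_def)
    then show ?thesis
      using chart_imp_homeomorphism[OF W(2)] W(1) ANR_homeomorphic_ANR homeomorphic_def homeomorphic_sym
      by blast
  qed
  have "ANR (\<Union>\<F>)"
    using \<F> op anr by (intro ANR_finite_Union_openin[of _ M]) auto
  moreover have "\<Union>\<F> = M"
    using \<F> op openin_imp_subset by blast
  ultimately show ?thesis by simp
qed

text \<open>A map into a power extends over a neighbourhood as soon as each of its finitely many components
  does.\<close>

lemma ANR_cart_power:
  fixes M :: "'a::euclidean_space set"
  assumes "ANR M"
  shows "ANR (cart_power M :: ('a^'k::finite) set)"
proof (rule absolute_neighbourhood_extensor_imp_ANR)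
  fix f :: "('a^'k) \<times> real \<Rightarrow> 'a^'k" and U T
  assume f: "continuous_on T f" "f \<in> T \<rightarrow> cart_power M" and clo: "closedin (top_of_set U) T"
  have "\<exists>V g. T \<subseteq> V \<and> openin (top_of_set U) V \<and> continuous_on V g \<and> g \<in> V \<rightarrow> M \<and>
      (\<forall>x\<in>T. g x = f x $ i)" for i
  proof -
    have "continuous_on T (\<lambda>x. f x $ i)" "(\<lambda>x. f x $ i) \<in> T \<rightarrow> M"
      using f by (auto simp: cart_power_def intro!: continuous_intros)
    from ANR_imp_absolute_neighbourhood_extensor[OF assms this clo] show ?thesis
      by metis
  qed
  then obtain V g where Vg: "\<And>i. T \<subseteq> V i" "\<And>i. openin (top_of_set U) (V i)"
    "\<And>i. continuous_on (V i) (g i)" "\<And>i. g i \<in> V i \<rightarrow> M" "\<And>i x. x \<in> T \<Longrightarrow> g i x = f x $ i"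
    by metis
  show "\<exists>V g. T \<subseteq> V \<and> openin (top_of_set U) V \<and> continuous_on V g \<and> g \<in> V \<rightarrow> cart_power M \<and>
      (\<forall>x\<in>T. g x = f x)"
  proof (intro exI conjI ballI)
    show "T \<subseteq> (\<Inter>i. V i)"
      using Vg(1) by blast
    show "openin (top_of_set U) (\<Inter>i. V i)"
      using Vg(2) by (intro openin_Inter) auto
    show "continuous_on (\<Inter>i. V i) (\<lambda>x. \<chi> i. g i x)"
      using Vg(3) by (intro continuous_on_vec_lambda) (auto intro: continuous_on_subset)
    show "(\<lambda>x. \<chi> i. g i x) \<in> (\<Inter>i. V i) \<rightarrow> cart_power M"
      using Vg(4) by (fastforce simp: cart_power_def)
    show "(\<chi> i. g i x) = f x" if "x \<in> T" for x
      using Vg(5)[OF that] by (simp add: vec_eq_iff)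
  qed
qed

lemma compact_cart_power:
  fixes M :: "'a::euclidean_space set"
  assumes "compact M"
  shows "compact (cart_power M :: ('a^'k::finite) set)"
proof -
  have "bounded (cart_power M :: ('a^'k) set)"
  proof -
    obtain B where B: "\<And>x. x \<in> M \<Longrightarrow> norm x \<le> B"
      using compact_imp_bounded[OF assms] by (auto simp: bounded_iff)
    have "norm x \<le> (\<Sum>i\<in>(UNIV::'k set). B)" if "x \<in> cart_power M" for x :: "'a^'k"
      using that B unfolding norm_vec_def
      by (intro order_trans[OF L2_set_le_sum] sum_mono) (auto simp: cart_power_def)
    then show ?thesis
      by (auto simp: bounded_iff)
  qed
  moreover have "closed (cart_power M :: ('a^'k) set)"
  proof -
    have "cart_power M = (\<Inter>i. (\<lambda>x :: 'a^'k. x $ i) -` M)"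
      by (auto simp: cart_power_def)
    moreover have "closed ((\<lambda>x :: 'a^'k. x $ i) -` M)" for i
      using compact_imp_closed[OF assms] by (intro continuous_closed_vimage) (auto intro!: continuous_intros)
    ultimately show ?thesis by auto
  qed
  ultimately show ?thesis
    by (simp add: compact_eq_bounded_closed)
qed

text \<open>Treating the basepoint as an additional coordinate, with index \<open>None\<close>, puts the condition
  \<open>x $ i = p0\<close> on the same footing as \<open>x $ i = x $ j\<close>.\<close>

definition coord :: "'a \<Rightarrow> 'a^'k \<Rightarrow> 'k option \<Rightarrow> 'a" where
  "coord p0 x j = (case j of None \<Rightarrow> p0 | Some i \<Rightarrow> x $ i)"

definition stratum :: "'a set \<Rightarrow> 'a \<Rightarrow> ('k option \<times> 'k option) set \<Rightarrow> ('a^'k) set" where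
  "stratum M p0 R = {x \<in> cart_power M. \<forall>(a, b)\<in>R. coord p0 x a = coord p0 x b}"

lemma continuous_on_coord:
  fixes p0 :: "'a::euclidean_space"
  shows "continuous_on S (\<lambda>x :: 'a^'k::finite. coord p0 x j)"
  by (cases j) (auto simp: coord_def intro!: continuous_intros)

text \<open>The retraction makes the coordinates constant on the classes of the equivalence relation generated
  by \<open>R\<close>, by copying a representative; in the class of \<open>None\<close> this has to be \<open>None\<close> itself, as the
  basepoint cannot be moved.\<close>

lemma stratum_retract_of_cart_power:
  fixes M :: "'a::euclidean_space set"
  assumes p0: "p0 \<in> M"
  shows "(stratum M p0 R :: ('a^'k::finite) set) retract_of cart_power M"
proof -
  define E where "E = (R \<union> R\<inverse>)\<^sup>*"
  have sym: "(b, a) \<in> E" if "(a, b) \<in> E" for a b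
    using sym_rtrancl[OF sym_Un_converse[of R]] that unfolding E_def by (rule symD)
  have trans: "(a, c) \<in> E" if "(a, b) \<in> E" "(b, c) \<in> E" for a b c
    using that unfolding E_def by (rule rtrancl_trans)
  have refl: "(a, a) \<in> E" for a
    by (simp add: E_def)
  define rep where "rep a = (if (a, None) \<in> E then None else SOME b. (a, b) \<in> E)" for a
  have rep_E: "(a, rep a) \<in> E" for a
    by (cases "(a, None) \<in> E") (simp_all add: rep_def someI[of "\<lambda>b. (a, b) \<in> E", OF refl])
  have rep_eq: "rep a = rep b" if "(a, b) \<in> E" for a b
  proof -
    have "(a, c) \<in> E \<longleftrightarrow> (b, c) \<in> E" for c
      using that sym trans by metis
    then show ?thesis by (simp add: rep_def)
  qed
  have rep_None: "rep None = None"
    using refl by (simp add: rep_def)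
  define r :: "'a^'k \<Rightarrow> 'a^'k" where "r x = (\<chi> i. coord p0 x (rep (Some i)))" for x
  have coord_r: "coord p0 (r x) a = coord p0 x (rep a)" for x a
    by (cases a) (auto simp: coord_def r_def rep_None)
  have coord_M: "coord p0 x a \<in> M" if "x \<in> cart_power M" for x :: "'a^'k" and a
    using that p0 by (auto simp: coord_def cart_power_def split: option.split)
  have E_eq: "coord p0 x a = coord p0 x b" if "x \<in> stratum M p0 R" "(a, b) \<in> E" for x :: "'a^'k" and a b
    using that(2) unfolding E_def
    by (induction rule: rtrancl_induct) (use that(1) in \<open>auto simp: stratum_def\<close>)
  have "continuous_on (cart_power M) r"
    unfolding r_def by (intro continuous_on_vec_lambda continuous_on_coord)
  moreover have "r \<in> cart_power M \<rightarrow> stratum M p0 R"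
  proof
    fix x :: "'a^'k" assume x: "x \<in> cart_power M"
    have "r x \<in> cart_power M"
      using coord_M[OF x] by (simp add: r_def cart_power_def)
    moreover have "coord p0 (r x) a = coord p0 (r x) b" if "(a, b) \<in> R" for a b
    proof -
      have "(a, b) \<in> E"
        using that unfolding E_def by blast
      then show ?thesis
        unfolding coord_r using rep_eq by simp
    qed
    ultimately show "r x \<in> stratum M p0 R"
      by (auto simp: stratum_def)
  qed
  moreover have "r x = x" if "x \<in> stratum M p0 R" for x
  proof -
    have "coord p0 x (rep (Some i)) = x $ i" for i
      using E_eq[OF that rep_E[of "Some i"]] by (simp add: coord_def)
    then show ?thesis
      by (simp add: r_def)
  qed
  moreover have "stratum M p0 R \<subseteq> (cart_power M :: ('a^'k) set)"
    by (auto simp: stratum_def)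
  ultimately show ?thesis
    unfolding retract_of_def retraction_def by blast
qed

lemma fat_diagonal_Un_basepoint_locus_eq:
  "(fat_diagonal M \<union> basepoint_locus M p0 :: ('a^'k) set) = (\<Union>(a, b)\<in>{(a, b). a \<noteq> b}. stratum M p0 {(a, b)})"
proof (intro subset_antisym subsetI)
  fix x :: "'a^'k" assume x: "x \<in> fat_diagonal M \<union> basepoint_locus M p0"
  then consider i j where "x \<in> cart_power M" "i \<noteq> j" "x $ i = x $ j"
    | i where "x \<in> cart_power M" "x $ i = p0"
    by (auto simp: fat_diagonal_def basepoint_locus_def)
  then show "x \<in> (\<Union>(a, b)\<in>{(a, b). a \<noteq> b}. stratum M p0 {(a, b)})"
  proof cases
    case 1
    then show ?thesis
      by (intro UN_I[of "(Some i, Some j)"]) (auto simp: stratum_def coord_def)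
  next
    case 2
    then show ?thesis
      by (intro UN_I[of "(Some i, None)"]) (auto simp: stratum_def coord_def)
  qed
next
  fix x :: "'a^'k" assume "x \<in> (\<Union>(a, b)\<in>{(a, b). a \<noteq> b}. stratum M p0 {(a, b)})"
  then obtain a b where "a \<noteq> b" "x \<in> cart_power M" "coord p0 x a = coord p0 x b"
    by (auto simp: stratum_def)
  then show "x \<in> fat_diagonal M \<union> basepoint_locus M p0"
    by (cases a; cases b) (auto simp: coord_def fat_diagonal_def basepoint_locus_def)
qed

text \<open>The locus is the union of the strata with a single equation, and these intersect in strata.\<close>

lemma fat_diagonal_Un_basepoint_locus:
  fixes M :: "'a::euclidean_space set"
  assumes M: "ANR M" "compact M" and p0: "p0 \<in> M"
  shows "ANR (fat_diagonal M \<union> basepoint_locus M p0 :: ('a^'k::finite) set)"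
    and "closed (fat_diagonal M \<union> basepoint_locus M p0 :: ('a^'k) set)"
proof -
  have retr: "(stratum M p0 R :: ('a^'k) set) retract_of cart_power M" for R
    using stratum_retract_of_cart_power[OF p0] .
  have anr: "ANR (stratum M p0 R :: ('a^'k) set)" for R
    using ANR_retract_of_ANR[OF ANR_cart_power[OF M(1)] retr] .
  have clo: "closed (stratum M p0 R :: ('a^'k) set)" for R
    using retract_of_compact[OF compact_cart_power[OF M(2)] retr] compact_imp_closed by blast
  have fin: "finite ({(a, b). a \<noteq> b} :: ('k option \<times> 'k option) set)"
    by (rule finite_subset[OF subset_UNIV]) simp
  show "closed (fat_diagonal M \<union> basepoint_locus M p0 :: ('a^'k) set)"
    unfolding fat_diagonal_Un_basepoint_locus_eq
    by (rule closed_UN[OF fin]) (use clo in auto)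
  show "ANR (fat_diagonal M \<union> basepoint_locus M p0 :: ('a^'k) set)"
    unfolding fat_diagonal_Un_basepoint_locus_eq
  proof (rule ANR_finite_UN_closed[OF fin])
    fix J :: "('k option \<times> 'k option) set" assume "J \<noteq> {}"
    then have "(\<Inter>ab\<in>J. case ab of (a, b) \<Rightarrow> stratum M p0 {(a, b)}) = stratum M p0 J"
      by (auto simp: stratum_def)
    then show "ANR (\<Inter>ab\<in>J. case ab of (a, b) \<Rightarrow> stratum M p0 {(a, b)})"
      using anr by simp
  qed (use clo in auto)
qed

section \<open>Deforming a neighbourhood into a closed subset\<close>

text \<open>Let \<open>r\<close> be a retraction onto \<open>A\<close> of a neighbourhood \<open>N0 \<subseteq> V\<close>. The identity at time 0, \<open>r\<close> at time 1
  and the constant homotopy on \<open>A\<close> form a map from a closed subset of \<open>[0, 1] \<times> N0\<close> to \<open>V\<close>. As \<open>V\<close> is an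
  absolute neighbourhood retract, it extends to a neighbourhood of this subset, which by compactness of
  \<open>[0, 1]\<close> contains \<open>[0, 1] \<times> N1\<close> for a neighbourhood \<open>N1\<close> of \<open>A\<close>. Slowing the homotopy down to a
  standstill towards the edge of \<open>N1\<close> makes it a deformation of all of \<open>X\<close>.\<close>

lemma neighbourhood_squeeze:
  fixes X :: "'a::euclidean_space set"
  assumes X: "ANR X" and A: "ANR A" and clo: "closedin (top_of_set X) A"
    and V: "openin (top_of_set X) V" "A \<subseteq> V"
  obtains N H where "openin (top_of_set X) N" "A \<subseteq> N"
    "continuous_on ({0..1::real} \<times> X) H" "H \<in> {0..1} \<times> X \<rightarrow> X"
    "\<And>x. x \<in> X \<Longrightarrow> H (0, x) = x" "\<And>t a. a \<in> A \<Longrightarrow> t \<in> {0..1} \<Longrightarrow> H (t, a) = a"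
    "\<And>t x. x \<in> N \<Longrightarrow> t \<in> {0..1} \<Longrightarrow> H (t, x) \<in> V" "\<And>x. x \<in> N \<Longrightarrow> H (1, x) \<in> A"
proof -
  have "A \<subseteq> X" "V \<subseteq> X"
    using clo V closedin_imp_subset openin_imp_subset by blast+
  have "closedin (top_of_set V) A"
    using closedin_subset_trans[OF clo V(2) \<open>V \<subseteq> X\<close>] .
  then obtain N0 where N0: "openin (top_of_set V) N0" "A retract_of N0"
    using ANR_imp_neighbourhood_retract[OF A] by blast
  then obtain r where r: "A \<subseteq> N0" "continuous_on N0 r" "r \<in> N0 \<rightarrow> A" "\<And>x. x \<in> A \<Longrightarrow> r x = x"
    unfolding retract_of_def retraction_def by blast
  have "N0 \<subseteq> V"
    using N0(1) openin_imp_subset by blast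
  have opN0: "openin (top_of_set X) N0"
    using N0(1) V(1) openin_trans by blast
  have cloA: "closedin (top_of_set N0) A"
    using closedin_subset_trans[OF clo r(1)] \<open>N0 \<subseteq> V\<close> \<open>V \<subseteq> X\<close> by blast
  define k0 where "k0 z = (if fst z = 1 then r (snd z) else snd z)" for z :: "real \<times> 'a"
  let ?C = "{1::real} \<times> N0 \<union> ({0} \<times> N0 \<union> {0..1} \<times> A)"
  have C_sub: "?C \<subseteq> {0..1::real} \<times> N0"
    using r(1) by auto
  have clo01: "closedin (top_of_set ({0..1::real} \<times> N0)) ({1} \<times> N0)"
    "closedin (top_of_set ({0..1::real} \<times> N0)) ({0} \<times> N0 \<union> {0..1} \<times> A)"
    by (intro closedin_Un closedin_Times; auto simp: closed_subset cloA)+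
  have contk0: "continuous_on ?C k0"
    unfolding k0_def
  proof (rule continuous_on_cases_local)
    show "closedin (top_of_set ?C) ({1} \<times> N0)"
      by (rule closedin_subset_trans[OF clo01(1) _ C_sub]) blast
    show "closedin (top_of_set ?C) ({0} \<times> N0 \<union> {0..1} \<times> A)"
      by (rule closedin_subset_trans[OF clo01(2) _ C_sub]) blast
    show "continuous_on ({1} \<times> N0) (\<lambda>z. r (snd z))"
      by (intro continuous_on_compose2[OF r(2)] continuous_intros) auto
    show "continuous_on ({0} \<times> N0 \<union> {0..1} \<times> A) snd"
      by (intro continuous_intros)
    show "\<And>z. z \<in> {1::real} \<times> N0 \<and> fst z \<noteq> 1 \<or> z \<in> {0} \<times> N0 \<union> {0..1} \<times> A \<and> fst z = 1 \<Longrightarrow> r (snd z) = snd z"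
      using r(4) by auto
  qed
  have k0V: "k0 \<in> ?C \<rightarrow> V"
  proof (rule funcsetI)
    fix z assume "z \<in> ?C"
    then have "snd z \<in> N0"
      using r(1) by auto
    then have "r (snd z) \<in> A" "snd z \<in> V"
      using r(3) \<open>N0 \<subseteq> V\<close> by blast+
    then show "k0 z \<in> V"
      using V(2) by (auto simp: k0_def)
  qed
  have "ANR V"
    using X V(1) ANR_openin by blast
  from ANR_imp_absolute_neighbourhood_extensor[OF this contk0 k0V closedin_Un[OF clo01]]
  obtain W k where W: "?C \<subseteq> W" "openin (top_of_set ({0..1} \<times> N0)) W" "continuous_on W k" "k \<in> W \<rightarrow> V"
    "\<And>z. z \<in> ?C \<Longrightarrow> k z = k0 z"
    by blast
  obtain N1 where N1: "openin (top_of_set N0) N1" "A \<subseteq> N1" "{0..1} \<times> N1 \<subseteq> W"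
    using tube_lemma_gen[of "{0..1::real}" A N0 W] W(1,2) r(1) by auto
  have "N1 \<subseteq> N0"
    using N1(1) openin_imp_subset by blast
  have opN1: "openin (top_of_set X) N1"
    using N1(1) opN0 openin_trans by blast
  have "closedin (top_of_set X) (X - N1)"
    using opN1 by (metis closedin_diff closedin_topspace topspace_euclidean_subtopology)
  moreover have "A \<inter> (X - N1) = {}"
    using N1(2) by blast
  ultimately obtain \<mu> :: "'a \<Rightarrow> real" where \<mu>: "continuous_on X \<mu>"
    "\<And>x. x \<in> A \<Longrightarrow> \<mu> x = 1" "\<And>x. x \<in> X - N1 \<Longrightarrow> \<mu> x = 0"
    using Urysohn_local[OF clo, of "X - N1" 1 0] by metis
  \<comment> \<open>\<open>cut\<close> is 1 on a whole neighbourhood of \<open>A\<close>, so that the deformation runs to its end there,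
    and 0 where \<open>\<mu> \<le> 1/3\<close>, so that it can be extended by the identity off \<open>N1\<close>.\<close>
  define cut where "cut x = max 0 (min 1 (3 * \<mu> x - 1))" for x
  have cut01: "cut x \<in> {0..1}" for x
    by (auto simp: cut_def)
  have contcut: "continuous_on X cut"
    unfolding cut_def by (intro continuous_intros \<mu>)
  define H where "H z = (if \<mu> (snd z) \<le> 1/3 then snd z else k (fst z * cut (snd z), snd z))"
    for z :: "real \<times> 'a"
  define N where "N = {x \<in> X. 2/3 < \<mu> x}"
  have N1_I: "x \<in> N1" if "x \<in> X" "\<mu> x \<noteq> 0" for x
    using that \<mu>(3) by blast
  have tcut: "t * cut x \<in> {0..1}" if "t \<in> {0..1}" for t x
    using that cut01[of x] by (auto intro: mult_nonneg_nonneg mult_le_one)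
  have kW: "(t * cut x, x) \<in> W" if "t \<in> {0..1}" "x \<in> N1" for t x
    using tcut[OF that(1)] that(2) N1(3) by blast
  have k_0: "k (0, x) = x" if "x \<in> N0" for x
    using that W(5) by (simp add: k0_def)
  have H_V: "H (t, x) \<in> V" if "t \<in> {0..1}" "x \<in> N1" for t x
    using kW[OF that] W(4) that \<open>N1 \<subseteq> N0\<close> \<open>N0 \<subseteq> V\<close> by (auto simp: H_def)
  let ?P = "{z \<in> {0..1::real} \<times> X. \<mu> (snd z) \<le> 1/3}"
  let ?Q = "{z \<in> {0..1::real} \<times> X. 1/3 \<le> \<mu> (snd z)}"
  have cont\<mu>: "continuous_on ({0..1::real} \<times> X) (\<lambda>z. \<mu> (snd z))"
    by (intro continuous_on_compose2[OF \<mu>(1)] continuous_intros) auto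
  have contH: "continuous_on ({0..1} \<times> X) H"
    unfolding H_def
  proof (rule continuous_on_cases_le[OF _ _ cont\<mu>])
    show "continuous_on ?P snd"
      by (intro continuous_intros)
    have "continuous_on ?Q (\<lambda>z. (fst z * cut (snd z), snd z))"
      by (intro continuous_intros continuous_on_compose2[OF contcut]) auto
    moreover have "(\<lambda>z. (fst z * cut (snd z), snd z)) ` ?Q \<subseteq> W"
    proof clarify
      fix t :: real and x assume "t \<in> {0..1}" "x \<in> X" "1/3 \<le> \<mu> (snd (t, x))"
      then show "(fst (t, x) * cut (snd (t, x)), snd (t, x)) \<in> W"
        using kW[of t x] N1_I[of x] by auto
    qed
    ultimately show "continuous_on ?Q (\<lambda>z. k (fst z * cut (snd z), snd z))"
      using continuous_on_compose2[OF W(3)] by blast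
    fix z :: "real \<times> 'a" assume "z \<in> {0..1} \<times> X" "\<mu> (snd z) = 1/3"
    then show "snd z = k (fst z * cut (snd z), snd z)"
      using k_0[of "snd z"] N1_I[of "snd z"] \<open>N1 \<subseteq> N0\<close> by (auto simp: cut_def)
  qed
  show ?thesis
  proof
    show "openin (top_of_set X) N"
      using continuous_openin_preimage_gen[OF \<mu>(1), of "{2/3<..}"]
      by (simp add: N_def vimage_def Collect_conj_eq)
    show "A \<subseteq> N"
      using \<mu>(2) \<open>A \<subseteq> X\<close> by (auto simp: N_def)
    show "continuous_on ({0..1} \<times> X) H" by (rule contH)
    show "H \<in> {0..1} \<times> X \<rightarrow> X"
    proof clarify
      fix t x assume t: "t \<in> {0..1::real}" and x: "x \<in> X"
      show "H (t, x) \<in> X"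
      proof (cases "x \<in> N1")
        case True
        then show ?thesis using H_V[OF t] \<open>V \<subseteq> X\<close> by blast
      next
        case False
        then show ?thesis using \<mu>(3)[of x] x by (simp add: H_def)
      qed
    qed
    show "H (0, x) = x" if "x \<in> X" for x
      using k_0[of x] N1_I[OF that] \<open>N1 \<subseteq> N0\<close> by (auto simp: H_def)
    show "H (t, a) = a" if "a \<in> A" "t \<in> {0..1}" for t a
    proof -
      have "(t, a) \<in> ?C" using that by auto
      then have "k (t, a) = a"
        using W(5) r(4)[OF that(1)] by (auto simp: k0_def)
      then show ?thesis
        using \<mu>(2)[OF that(1)] by (simp add: H_def cut_def)
    qed
    show "H (t, x) \<in> V" if "x \<in> N" "t \<in> {0..1}" for t x
      using that N1_I[of x] by (intro H_V) (auto simp: N_def)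
    show "H (1, x) \<in> A" if "x \<in> N" for x
    proof -
      have x: "x \<in> N0" "cut x = 1" "\<mu> x > 1/3"
        using that N1_I[of x] \<open>N1 \<subseteq> N0\<close> by (auto simp: N_def cut_def)
      then have "H (1, x) = k (1, x)"
        by (simp add: H_def)
      also have "\<dots> = r x"
        using W(5)[of "(1, x)"] x(1) by (simp add: k0_def)
      finally show ?thesis
        using r(3) x(1) by auto
    qed
  qed
qed

section \<open>Locally finite chains and their finite truncations\<close>

text \<open>Locally finite chains are handled through finite chains that agree with them near a given compact
  set. Identities between locally finite chains then follow from the corresponding
  identities for finite chains.\<close>

definition agree_on :: "nat \<Rightarrow> 'a set \<Rightarrow> 'a lf_chain \<Rightarrow> 'a chain \<Rightarrow> bool" where
  "agree_on p K c d \<longleftrightarrow>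
     (\<forall>\<sigma>. \<sigma> ` standard_simplex p \<inter> K \<noteq> {} \<longrightarrow> c \<sigma> = Poly_Mapping.lookup d \<sigma>)"

lemma agree_onD:
  "\<lbrakk>agree_on p K c d; \<sigma> ` standard_simplex p \<inter> K \<noteq> {}\<rbrakk> \<Longrightarrow> c \<sigma> = Poly_Mapping.lookup d \<sigma>"
  by (simp add: agree_on_def)

lemma agree_on_mono: "\<lbrakk>agree_on p L c d; K \<subseteq> L\<rbrakk> \<Longrightarrow> agree_on p K c d"
  unfolding agree_on_def by blast

lemma agree_on_add:
  "\<lbrakk>agree_on p K c d; agree_on p K c' d'\<rbrakk> \<Longrightarrow> agree_on p K (\<lambda>\<sigma>. c \<sigma> + c' \<sigma>) (d + d')"
  by (simp add: agree_on_def lookup_add)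

lemma agree_on_zero_iff:
  assumes "singular_chain p X d"
  shows "agree_on p K (\<lambda>_. 0) d \<longleftrightarrow> singular_chain p (subtopology X (topspace X - K)) d"
proof -
  have "\<sigma> ` standard_simplex p \<subseteq> topspace X" if "\<sigma> \<in> Poly_Mapping.keys d" for \<sigma>
    using assms that unfolding singular_chain_def singular_simplex_def continuous_map_def
    by (fastforce simp: topspace_standard_simplex)
  then show ?thesis
    using assms unfolding singular_chain_subtopology agree_on_def
    by (fastforce simp: in_keys_iff)
qed

lemma agree_on_diff_chain:
  assumes "agree_on p K c d" "agree_on p K c d'" "singular_chain p X d" "singular_chain p X d'"
  shows "singular_chain p (subtopology X (topspace X - K)) (d - d')"
proof -
  have "agree_on p K (\<lambda>_. 0) (d - d')"
    using assms(1,2) by (auto simp: agree_on_def lookup_minus)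
  then show ?thesis
    using agree_on_zero_iff singular_chain_diff assms(3,4) by blast
qed

text \<open>For a given \<open>\<tau>\<close> only those \<open>\<sigma>\<close> matter whose image under \<open>F\<close> involves \<open>\<tau>\<close>, so \<open>c\<close> may be replaced by
  any finite chain with the same coefficients there.\<close>

lemma lf_extend_eq_lookup:
  assumes "\<And>\<sigma>. \<tau> \<in> Poly_Mapping.keys (F \<sigma>) \<Longrightarrow> c \<sigma> = Poly_Mapping.lookup d \<sigma>"
  shows "lf_extend F c \<tau> = Poly_Mapping.lookup (frag_extend F d) \<tau>"
proof -
  have "lf_extend F c \<tau> = (\<Sum>\<sigma> | c \<sigma> \<noteq> 0 \<and> \<tau> \<in> Poly_Mapping.keys (F \<sigma>).
     Poly_Mapping.lookup d \<sigma> * Poly_Mapping.lookup (F \<sigma>) \<tau>)"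
    unfolding lf_extend_def using assms by (intro sum.cong) auto
  also have "\<dots> = (\<Sum>\<sigma>\<in>Poly_Mapping.keys d. Poly_Mapping.lookup d \<sigma> * Poly_Mapping.lookup (F \<sigma>) \<tau>)"
    by (rule sum.mono_neutral_left) (use assms in \<open>auto simp: in_keys_iff\<close>)
  also have "\<dots> = Poly_Mapping.lookup (frag_extend F d) \<tau>"
    by (simp add: frag_extend_def lookup_sum)
  finally show ?thesis .
qed

lemma lf_extend_nonzeroE:
  assumes "lf_extend F c \<tau> \<noteq> 0"
  obtains \<sigma> where "c \<sigma> \<noteq> 0" "\<tau> \<in> Poly_Mapping.keys (F \<sigma>)"
  using assms unfolding lf_extend_def
  by (metis (mono_tags, lifting) mem_Collect_eq sum.not_neutral_contains_not_neutral)

lemma chain_boundary_conv_extend: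
  "chain_boundary p c = frag_extend (\<lambda>\<sigma>. chain_boundary p (frag_of \<sigma>)) c"
proof (cases "p = 0")
  case True
  have "frag_extend (\<lambda>\<sigma>. 0 :: 'a chain) c = 0"
    by (rule frag_extend_eq_0) simp
  then show ?thesis
    by (simp add: chain_boundary_def True)
qed (simp add: chain_boundary_def)

lemma chain_map_conv_extend:
  "chain_map p f c = frag_extend (\<lambda>\<sigma>. chain_map p f (frag_of \<sigma>)) c"
  by (simp add: chain_map_def o_def)

lemma image_subset_of_boundary_key:
  assumes "\<tau> \<in> Poly_Mapping.keys (chain_boundary p (frag_of \<sigma>))"
  shows "\<tau> ` standard_simplex (p - 1) \<subseteq> \<sigma> ` standard_simplex p"
proof (cases "p = 0")
  case False
  have "\<tau> \<in> (\<Union>k\<in>{..p}. Poly_Mapping.keys (frag_cmul ((-1) ^ k) (frag_of (singular_face p k \<sigma>))))"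
    using assms False keys_sum by (fastforce simp: chain_boundary_of)
  then obtain k where k: "k \<le> p" "\<tau> = singular_face p k \<sigma>"
    by (auto split: if_splits)
  then show ?thesis
    using False by (auto simp: singular_face_def intro!: imageI simplical_face_in_standard_simplex)
qed (use assms in \<open>simp add: chain_boundary_def\<close>)

text \<open>A simplex one of whose faces meets \<open>K\<close> meets \<open>K\<close> itself.\<close>

lemma agree_on_boundary:
  assumes "agree_on p K c d"
  shows "agree_on (p - 1) K (lf_boundary p c) (chain_boundary p d)"
  unfolding agree_on_def
proof (intro allI impI)
  fix \<tau> assume "\<tau> ` standard_simplex (p - 1) \<inter> K \<noteq> {}"
  then have "c \<sigma> = Poly_Mapping.lookup d \<sigma>"
    if "\<tau> \<in> Poly_Mapping.keys (chain_boundary p (frag_of \<sigma>))" for \<sigma>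
    using image_subset_of_boundary_key[OF that] by (intro agree_onD[OF assms]) blast
  then show "lf_boundary p c \<tau> = Poly_Mapping.lookup (chain_boundary p d) \<tau>"
    unfolding lf_boundary_def chain_boundary_conv_extend[of p d] by (rule lf_extend_eq_lookup)
qed

lemma lf_chain_truncate:
  assumes "lf_chain p X c" "compactin X K"
  obtains d where "singular_chain p X d" "agree_on p K c d"
proof -
  define S where "S = {\<sigma>. c \<sigma> \<noteq> 0 \<and> \<sigma> ` standard_simplex p \<inter> K \<noteq> {}}"
  have fin: "finite S"
    using assms by (simp add: lf_chain_def S_def)
  define d where "d = (\<Sum>\<sigma>\<in>S. frag_cmul (c \<sigma>) (frag_of \<sigma>))"
  have lookup_d: "Poly_Mapping.lookup d \<sigma> = (if \<sigma> \<in> S then c \<sigma> else 0)" for \<sigma>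
    using fin by (simp add: d_def lookup_sum if_distrib[of "\<lambda>x. _ * x"] cong: if_cong)
  have "singular_chain p X d"
    unfolding d_def using assms(1)
    by (intro singular_chain_sum singular_chain_cmul) (auto simp: S_def lf_chain_def singular_chain_of)
  moreover have "agree_on p K c d"
    by (auto simp: agree_on_def lookup_d S_def)
  ultimately show ?thesis
    using that by blast
qed

lemma compactin_simplex_image:
  assumes "singular_simplex p X \<sigma>"
  shows "compactin X (\<sigma> ` standard_simplex p)"
  using assms unfolding singular_simplex_def
  by (intro image_compactin[of "subtopology (powertop_real UNIV) (standard_simplex p)"])
    (auto simp: compactin_subtopology compactin_standard_simplex)

text \<open>Each simplex has compact image, so agreement near all compact sets is equality.\<close>

lemma lf_chain_ext:
  assumes "\<And>\<sigma>. c \<sigma> \<noteq> 0 \<Longrightarrow> singular_simplex p X \<sigma>" "\<And>\<sigma>. c' \<sigma> \<noteq> 0 \<Longrightarrow> singular_simplex p X \<sigma>"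
    and "\<And>K. compactin X K \<Longrightarrow> \<exists>d. agree_on p K c d \<and> agree_on p K c' d"
  shows "c = c'"
proof
  fix \<sigma>
  show "c \<sigma> = c' \<sigma>"
  proof (cases "singular_simplex p X \<sigma>")
    case True
    then obtain d where "agree_on p (\<sigma> ` standard_simplex p) c d" "agree_on p (\<sigma> ` standard_simplex p) c' d"
      using assms(3)[OF compactin_simplex_image[OF True]] by blast
    then show ?thesis
      by (simp add: agree_on_def nonempty_standard_simplex)
  next
    case False
    then show ?thesis
      using assms(1)[of \<sigma>] assms(2)[of \<sigma>] by metis
  qed
qed

lemma lf_chainI:
  assumes "\<And>\<sigma>. c \<sigma> \<noteq> 0 \<Longrightarrow> singular_simplex p X \<sigma>"
    and "\<And>K. compactin X K \<Longrightarrow> \<exists>d. agree_on p K c d"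
  shows "lf_chain p X c"
  unfolding lf_chain_def
proof (intro conjI allI impI)
  fix K assume "compactin X K"
  from assms(2)[OF this] obtain d where d: "agree_on p K c d" ..
  have "{\<sigma>. c \<sigma> \<noteq> 0 \<and> \<sigma> ` standard_simplex p \<inter> K \<noteq> {}} \<subseteq> Poly_Mapping.keys d"
  proof
    fix \<sigma> assume "\<sigma> \<in> {\<sigma>. c \<sigma> \<noteq> 0 \<and> \<sigma> ` standard_simplex p \<inter> K \<noteq> {}}"
    then show "\<sigma> \<in> Poly_Mapping.keys d"
      using agree_onD[OF d, of \<sigma>] by (simp add: in_keys_iff)
  qed
  then show "finite {\<sigma>. c \<sigma> \<noteq> 0 \<and> \<sigma> ` standard_simplex p \<inter> K \<noteq> {}}"
    by (rule finite_subset) simp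
qed (rule assms(1))

lemma lf_boundary_support:
  assumes "lf_chain p X c" "lf_boundary p c \<tau> \<noteq> 0"
  shows "singular_simplex (p - 1) X \<tau>"
proof -
  obtain \<sigma> where \<sigma>: "c \<sigma> \<noteq> 0" "\<tau> \<in> Poly_Mapping.keys (chain_boundary p (frag_of \<sigma>))"
    using assms(2) unfolding lf_boundary_def by (rule lf_extend_nonzeroE)
  have "singular_chain p X (frag_of \<sigma>)"
    using assms(1) \<sigma>(1) by (simp add: lf_chain_def singular_chain_of)
  from singular_chain_boundary[OF this] \<sigma>(2) show ?thesis
    by (auto simp: singular_chain_def)
qed

lemma lf_chain_boundary:
  assumes "lf_chain p X c"
  shows "lf_chain (p - 1) X (lf_boundary p c)"
proof (rule lf_chainI)
  fix K assume "compactin X K"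
  then obtain d where "agree_on p K c d"
    using lf_chain_truncate[OF assms] by blast
  from agree_on_boundary[OF this] show "\<exists>d. agree_on (p - 1) K (lf_boundary p c) d" ..
qed (rule lf_boundary_support[OF assms])

lemma lf_chain_zero: "lf_chain p X (\<lambda>_. 0)"
  by (simp add: lf_chain_def)

lemma lf_chain_add:
  assumes "lf_chain p X c" "lf_chain p X c'"
  shows "lf_chain p X (\<lambda>\<sigma>. c \<sigma> + c' \<sigma>)"
proof (rule lf_chainI)
  show "singular_simplex p X \<sigma>" if "c \<sigma> + c' \<sigma> \<noteq> 0" for \<sigma>
    using assms that by (metis add_0 lf_chain_def)
  fix K assume K: "compactin X K"
  obtain d where d: "agree_on p K c d" using lf_chain_truncate[OF assms(1) K] .
  obtain d' where d': "agree_on p K c' d'" using lf_chain_truncate[OF assms(2) K] .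
  from agree_on_add[OF d d'] show "\<exists>d. agree_on p K (\<lambda>\<sigma>. c \<sigma> + c' \<sigma>) d" ..
qed

lemma lf_chain_minus:
  assumes "lf_chain p X c"
  shows "lf_chain p X (\<lambda>\<sigma>. - c \<sigma>)"
  using assms by (simp add: lf_chain_def)

lemma lf_boundary_zero [simp]: "lf_boundary p (\<lambda>_. 0) = (\<lambda>_. 0)"
  by (simp add: lf_boundary_def lf_extend_def)

lemma lf_boundary_add:
  assumes "lf_chain p X c" "lf_chain p X c'"
  shows "lf_boundary p (\<lambda>\<sigma>. c \<sigma> + c' \<sigma>) = (\<lambda>\<tau>. lf_boundary p c \<tau> + lf_boundary p c' \<tau>)"
proof (rule lf_chain_ext[of _ "p - 1" X])
  show "singular_simplex (p - 1) X \<tau>" if "lf_boundary p (\<lambda>\<sigma>. c \<sigma> + c' \<sigma>) \<tau> \<noteq> 0" for \<tau>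
    using lf_boundary_support[OF lf_chain_add[OF assms] that] .
  show "singular_simplex (p - 1) X \<tau>" if "lf_boundary p c \<tau> + lf_boundary p c' \<tau> \<noteq> 0" for \<tau>
    using lf_boundary_support[OF assms(1)] lf_boundary_support[OF assms(2)] that by (metis add_0)
  fix K assume K: "compactin X K"
  obtain d where d: "agree_on p K c d" using lf_chain_truncate[OF assms(1) K] .
  obtain d' where d': "agree_on p K c' d'" using lf_chain_truncate[OF assms(2) K] .
  have "agree_on (p - 1) K (lf_boundary p (\<lambda>\<sigma>. c \<sigma> + c' \<sigma>)) (chain_boundary p (d + d'))"
    by (intro agree_on_boundary agree_on_add d d')
  moreover have "agree_on (p - 1) K (\<lambda>\<tau>. lf_boundary p c \<tau> + lf_boundary p c' \<tau>) (chain_boundary p (d + d'))"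
    unfolding chain_boundary_add by (intro agree_on_boundary agree_on_add d d')
  ultimately show "\<exists>d. agree_on (p - 1) K (lf_boundary p (\<lambda>\<sigma>. c \<sigma> + c' \<sigma>)) d \<and>
      agree_on (p - 1) K (\<lambda>\<tau>. lf_boundary p c \<tau> + lf_boundary p c' \<tau>) d"
    by blast
qed

lemma lf_boundary_minus: "lf_boundary p (\<lambda>\<sigma>. - c \<sigma>) = (\<lambda>\<tau>. - lf_boundary p c \<tau>)"
  by (simp add: lf_boundary_def lf_extend_def sum_negf)

lemma lf_boundary_boundary:
  assumes "lf_chain p X c"
  shows "lf_boundary (p - 1) (lf_boundary p c) = (\<lambda>_. 0)"
proof (rule lf_chain_ext[of _ "p - 1 - 1" X])
  show "singular_simplex (p - 1 - 1) X \<tau>" if "lf_boundary (p - 1) (lf_boundary p c) \<tau> \<noteq> 0" for \<tau>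
    using lf_boundary_support[OF lf_chain_boundary[OF assms] that] .
  fix K assume "compactin X K"
  then obtain d where d: "singular_chain p X d" "agree_on p K c d"
    using lf_chain_truncate[OF assms] by blast
  have "agree_on (p - 1 - 1) K (lf_boundary (p - 1) (lf_boundary p c)) 0"
    using agree_on_boundary[OF agree_on_boundary[OF d(2)]] chain_boundary_boundary[OF d(1)] by simp
  then show "\<exists>d. agree_on (p - 1 - 1) K (lf_boundary (p - 1) (lf_boundary p c)) d \<and>
      agree_on (p - 1 - 1) K (\<lambda>_. 0) d"
    by (intro exI[of _ 0]) (simp add: agree_on_def)
qed simp

section \<open>Push-forward of locally finite chains along homeomorphisms\<close>

lemma agree_on_chain_map:
  assumes "homeomorphic_maps U V f g" "lf_chain p U c" "singular_chain p U d"
    and "agree_on p (g ` K) c d"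
  shows "agree_on p K (lf_chain_map p f c) (chain_map p f d)"
  unfolding agree_on_def
proof (intro allI impI)
  fix \<tau> assume \<tau>: "\<tau> ` standard_simplex p \<inter> K \<noteq> {}"
  have "c \<sigma> = Poly_Mapping.lookup d \<sigma>"
    if "\<tau> \<in> Poly_Mapping.keys (chain_map p f (frag_of \<sigma>))" for \<sigma>
  proof (cases "singular_simplex p U \<sigma>")
    case True
    have "\<tau> = restrict (f \<circ> \<sigma>) (standard_simplex p)"
      using that by (simp add: simplex_map_def)
    then obtain x where x: "x \<in> standard_simplex p" "f (\<sigma> x) \<in> K"
      using \<tau> by auto
    have "\<sigma> x \<in> topspace U"
      using True x(1) by (auto simp: singular_simplex_def continuous_map_def)
    then have "\<sigma> x \<in> g ` K"
      using assms(1) x(2) by (auto simp: homeomorphic_maps_def intro: rev_image_eqI)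
    then show ?thesis
      using x(1) by (intro agree_onD[OF assms(4)]) blast
  next
    case False
    then show ?thesis
      using assms(2,3) by (metis (mono_tags) in_keys_iff lf_chain_def mem_Collect_eq singular_chain_def subsetD)
  qed
  then show "lf_chain_map p f c \<tau> = Poly_Mapping.lookup (chain_map p f d) \<tau>"
    unfolding lf_chain_map_def chain_map_conv_extend[of p f d] by (rule lf_extend_eq_lookup)
qed

lemma lf_chain_map_support:
  assumes "continuous_map U V f" "lf_chain p U c" "lf_chain_map p f c \<tau> \<noteq> 0"
  shows "singular_simplex p V \<tau>"
proof -
  obtain \<sigma> where \<sigma>: "c \<sigma> \<noteq> 0" "\<tau> \<in> Poly_Mapping.keys (chain_map p f (frag_of \<sigma>))"
    using assms(3) unfolding lf_chain_map_def by (rule lf_extend_nonzeroE)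
  then show ?thesis
    using assms(1,2) singular_simplex_simplex_map[of p U \<sigma> V f] by (simp add: lf_chain_def)
qed

lemma homeomorphic_maps_truncate:
  assumes "homeomorphic_maps U V f g" "lf_chain p U c" "compactin V K"
  obtains d where "singular_chain p U d" "agree_on p (g ` K) c d"
    "agree_on p K (lf_chain_map p f c) (chain_map p f d)"
proof -
  have "compactin U (g ` K)"
    using assms(1,3) image_compactin by (auto simp: homeomorphic_maps_def)
  then obtain d where "singular_chain p U d" "agree_on p (g ` K) c d"
    using lf_chain_truncate[OF assms(2)] by blast
  then show ?thesis
    using that agree_on_chain_map[OF assms(1,2)] by blast
qed

lemma lf_chain_chain_map:
  assumes "homeomorphic_maps U V f g" "lf_chain p U c"
  shows "lf_chain p V (lf_chain_map p f c)"
proof (rule lf_chainI)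
  show "singular_simplex p V \<tau>" if "lf_chain_map p f c \<tau> \<noteq> 0" for \<tau>
    using lf_chain_map_support assms that by (auto simp: homeomorphic_maps_def)
  fix K assume K: "compactin V K"
  obtain d where "agree_on p K (lf_chain_map p f c) (chain_map p f d)"
    using homeomorphic_maps_truncate[OF assms K] .
  then show "\<exists>d. agree_on p K (lf_chain_map p f c) d" ..
qed

lemma lf_boundary_chain_map:
  assumes fg: "homeomorphic_maps U V f g" and c: "lf_chain p U c"
  shows "lf_boundary p (lf_chain_map p f c) = lf_chain_map (p - 1) f (lf_boundary p c)"
proof (rule lf_chain_ext[of _ "p - 1" V])
  show "singular_simplex (p - 1) V \<tau>" if "lf_boundary p (lf_chain_map p f c) \<tau> \<noteq> 0" for \<tau>
    using lf_boundary_support[OF lf_chain_chain_map[OF assms] that] .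
  show "singular_simplex (p - 1) V \<tau>" if "lf_chain_map (p - 1) f (lf_boundary p c) \<tau> \<noteq> 0" for \<tau>
    using lf_chain_map_support lf_chain_boundary[OF c] that fg by (auto simp: homeomorphic_maps_def)
  fix K assume K: "compactin V K"
  obtain d where d: "singular_chain p U d" "agree_on p (g ` K) c d"
    "agree_on p K (lf_chain_map p f c) (chain_map p f d)"
    using homeomorphic_maps_truncate[OF assms K] .
  have "agree_on (p - 1) K (lf_chain_map (p - 1) f (lf_boundary p c)) (chain_map (p - 1) f (chain_boundary p d))"
    using singular_chain_boundary[OF d(1)]
    by (intro agree_on_chain_map[OF fg] lf_chain_boundary[OF c] agree_on_boundary d) auto
  then show "\<exists>e. agree_on (p - 1) K (lf_boundary p (lf_chain_map p f c)) e \<and>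
      agree_on (p - 1) K (lf_chain_map (p - 1) f (lf_boundary p c)) e"
    using agree_on_boundary[OF d(3)] chain_boundary_chain_map[OF d(1), of f] by auto
qed

lemma lf_chain_map_add:
  assumes fg: "homeomorphic_maps U V f g" and c: "lf_chain p U c" "lf_chain p U c'"
  shows "lf_chain_map p f (\<lambda>\<sigma>. c \<sigma> + c' \<sigma>) = (\<lambda>\<tau>. lf_chain_map p f c \<tau> + lf_chain_map p f c' \<tau>)"
proof (rule lf_chain_ext[of _ p V])
  have cont: "continuous_map U V f"
    using fg by (auto simp: homeomorphic_maps_def)
  show "singular_simplex p V \<tau>" if "lf_chain_map p f (\<lambda>\<sigma>. c \<sigma> + c' \<sigma>) \<tau> \<noteq> 0" for \<tau>
    using lf_chain_map_support[OF cont lf_chain_add[OF c] that] .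
  show "singular_simplex p V \<tau>" if "lf_chain_map p f c \<tau> + lf_chain_map p f c' \<tau> \<noteq> 0" for \<tau>
    using lf_chain_map_support[OF cont c(1)] lf_chain_map_support[OF cont c(2)] that by (metis add_0)
  fix K assume K: "compactin V K"
  obtain d where d: "singular_chain p U d" "agree_on p (g ` K) c d"
    "agree_on p K (lf_chain_map p f c) (chain_map p f d)"
    using homeomorphic_maps_truncate[OF fg c(1) K] .
  obtain d' where d': "singular_chain p U d'" "agree_on p (g ` K) c' d'"
    "agree_on p K (lf_chain_map p f c') (chain_map p f d')"
    using homeomorphic_maps_truncate[OF fg c(2) K] .
  have "agree_on p K (lf_chain_map p f (\<lambda>\<sigma>. c \<sigma> + c' \<sigma>)) (chain_map p f (d + d'))"
    by (intro agree_on_chain_map[OF fg] lf_chain_add c agree_on_add d d' singular_chain_add)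
  then show "\<exists>d. agree_on p K (lf_chain_map p f (\<lambda>\<sigma>. c \<sigma> + c' \<sigma>)) d \<and>
      agree_on p K (\<lambda>\<tau>. lf_chain_map p f c \<tau> + lf_chain_map p f c' \<tau>) d"
    using agree_on_add[OF d(3) d'(3)] by (auto simp: chain_map_add)
qed

section \<open>Relative cycles and locally finite cycles\<close>

lemma homologous_rel_subset:
  assumes "homologous_rel p X S a b" "S \<subseteq> T"
  shows "homologous_rel p X T a b"
  using assms unfolding homologous_rel_def singular_relboundary
  using singular_chain_mono by metis

lemma singular_relboundary_subset:
  assumes "singular_relboundary p X S a" "S \<subseteq> T"
  shows "singular_relboundary p X T a"
  using assms unfolding singular_relboundary
  using singular_chain_mono by metis

lemma singular_relcycle_subset:
  assumes "singular_relcycle p X S a" "S \<subseteq> T"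
  shows "singular_relcycle p X T a"
  using assms unfolding singular_relcycle
  using singular_chain_mono by metis

lemma homologous_rel_chain_diff:
  "singular_chain p (subtopology X S) (a - b) \<Longrightarrow> homologous_rel p X S a b"
  by (simp add: homologous_rel_def singular_chain_imp_relboundary)

text \<open>The relation that turns into the comparison isomorphism: \<open>\<zeta>\<close> and \<open>w\<close> have the same image in
  \<open>H\<^sub>p(X, X - L)\<close> for all compact \<open>L\<close> disjoint from \<open>A\<close>. The choice of \<open>d\<close> is immaterial, since
  two chains that agree with \<open>w\<close> near \<open>L\<close> differ by a chain in \<open>X - L\<close>.\<close>

definition BM_related ::
  "nat \<Rightarrow> 'a topology \<Rightarrow> 'a set \<Rightarrow> 'a chain \<Rightarrow> 'a lf_chain \<Rightarrow> bool" where
  "BM_related p X A \<zeta> w \<longleftrightarrow>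
     (\<forall>L. compactin (subtopology X (topspace X - A)) L \<longrightarrow>
        (\<exists>d. singular_chain p (subtopology X (topspace X - A)) d \<and> agree_on p L w d \<and>
             homologous_rel p X (topspace X - L) \<zeta> d))"

text \<open>The maps \<open>h n\<close> induce \<open>H\<^sub>p(X, X - K (n + 1)) \<rightarrow> H\<^sub>p(X, A)\<close>. By \<open>h_rel_A\<close> and \<open>h_rel_K\<close> the composites
  with the maps induced by inclusions are the identity of \<open>H\<^sub>p(X, A)\<close> and the transition map
  \<open>H\<^sub>p(X, X - K (n + 1)) \<rightarrow> H\<^sub>p(X, X - K n)\<close>, respectively. So these groups form an inverse system that is
  constant up to pro-isomorphism.\<close>

locale tame_pair =
  fixes X :: "'a topology" and A :: "'a set" and K :: "nat \<Rightarrow> 'a set" and h :: "nat \<Rightarrow> 'a \<Rightarrow> 'a"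
  assumes Hausdorff: "Hausdorff_space X"
    and closed_A: "closedin X A"
    and K_compact: "compactin (subtopology X (topspace X - A)) (K n)"
    and K_Suc: "K n \<subseteq> K (Suc n)"
    and K_exhaust: "compactin (subtopology X (topspace X - A)) L \<Longrightarrow> \<exists>n. L \<subseteq> K n"
    and h_squeeze: "h n \<in> (topspace X - K (Suc n)) \<rightarrow> A"
    and h_rel_A: "homotopic_with (\<lambda>f. f \<in> A \<rightarrow> A) X X (h n) id"
    and h_rel_K: "homotopic_with
                    (\<lambda>f. f \<in> (topspace X - K (Suc n)) \<rightarrow> (topspace X - K n)) X X (h n) id"
begin

abbreviation U where "U \<equiv> subtopology X (topspace X - A)"

lemma K_mono: "m \<le> n \<Longrightarrow> K m \<subseteq> K n"
  by (rule lift_Suc_mono_le[of K]) (rule K_Suc)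

lemma A_subset: "A \<subseteq> topspace X"
  using closed_A closedin_subset by blast

lemma compact_avoids:
  assumes "compactin U L"
  shows "L \<subseteq> topspace X" "L \<inter> A = {}" "openin X (topspace X - L)" "A \<subseteq> topspace X - L"
proof -
  have L: "compactin X L" "L \<subseteq> topspace X - A"
    using assms by (auto simp: compactin_subtopology)
  then show "L \<subseteq> topspace X" "L \<inter> A = {}" "A \<subseteq> topspace X - L"
    using A_subset by auto
  show "openin X (topspace X - L)"
    using L(1) Hausdorff compactin_imp_closedin by (intro openin_diff) auto
qed

lemma chain_U_imp: "singular_chain p U c \<Longrightarrow> singular_chain p X c"
  using singular_chain_subtopology by blast

lemma avoid_U:
  assumes "singular_chain p (subtopology U (topspace U - L)) r"
  shows "singular_chain p U r" "singular_chain p (subtopology X (topspace X - L)) r"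
  using assms by (fastforce simp: singular_chain_subtopology)+

text \<open>Surjectivity part of excision of \<open>A\<close>, for chains.\<close>

lemma excise_cycle:
  assumes L: "compactin U L" and c: "singular_relcycle p X (topspace X - L) c"
  obtains d where "singular_chain p U d" "homologous_rel p X (topspace X - L) c d"
proof -
  note L' = compact_avoids[OF L]
  have "X closure_of A \<subseteq> X interior_of (topspace X - L)"
    using L' closed_A by (simp add: closure_of_closedin interior_of_openin)
  from excised_relcycle_exists[OF this, of "topspace X" p c] c
  obtain d where "singular_relcycle p U (topspace X - L - A) d" "homologous_rel p X (topspace X - L) c d"
    by auto
  then show ?thesis
    using that by (auto simp: singular_relcycle)
qed

text \<open>Injectivity part of excision of \<open>A\<close>, for chains.\<close>

lemma excise_boundary:
  assumes L: "compactin U L" and c: "singular_chain p U c" "singular_relboundary p X (topspace X - L) c"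
  obtains e r where "singular_chain (Suc p) U e" "singular_chain p (subtopology U (topspace U - L)) r"
    "c = chain_boundary (Suc p) e + r"
proof -
  note L' = compact_avoids[OF L]
  define T where "T = topspace X - L"
  have clo: "X closure_of A \<subseteq> X interior_of T"
    using L' closed_A by (simp add: closure_of_closedin interior_of_openin T_def)
  have T: "T \<subseteq> topspace X" by (auto simp: T_def)
  have iso: "hom_induced p U (T - A) X T id
      \<in> iso (relative_homology_group p U (T - A)) (relative_homology_group p X T)"
    using homology_excision_axiom[OF clo T, of p] by simp
  have cX: "singular_chain p X c"
    using chain_U_imp[OF c(1)] .
  have cyc: "singular_relcycle p X T c"
    using c(2) singular_relboundary_imp_relcycle unfolding T_def by blast
  have cycU: "singular_relcycle p U (T - A) c"
    using cyc c(1) singular_chain_boundary[OF c(1)]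
    unfolding singular_relcycle by (fastforce simp: singular_chain_subtopology)
  have id_ind: "hom_induced p U (T - A) X T id (homologous_rel_set p U (T - A) b)
      = homologous_rel_set p X T b" if "singular_relcycle p U (T - A) b" for b
  proof -
    have "chain_map p id b = b"
      using that by (intro chain_map_ident) (auto simp: singular_relcycle)
    then show ?thesis
      using hom_induced_chain_map[of U X id "T - A" T p b] that
      by (simp add: continuous_map_from_subtopology)
  qed
  have "homologous_rel_set p X T c = homologous_rel_set p X T 0"
    using c(2) unfolding homologous_rel_set_eq by (simp add: homologous_rel_def T_def)
  then have "hom_induced p U (T - A) X T id (homologous_rel_set p U (T - A) c)
      = hom_induced p U (T - A) X T id (homologous_rel_set p U (T - A) 0)"
    using id_ind cycU by simp
  note eq = this
  have car: "homologous_rel_set p U (T - A) b \<in> carrier (relative_homology_group p U (T - A))"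
    if "singular_relcycle p U (T - A) b" for b
    using that by (auto simp: carrier_relative_homology_group)
  have "inj_on (hom_induced p U (T - A) X T id) (carrier (relative_homology_group p U (T - A)))"
    using iso by (simp add: iso_def bij_betw_def)
  from inj_onD[OF this eq car[OF cycU] car[OF singular_relcycle_0]]
  have "homologous_rel_set p U (T - A) c = homologous_rel_set p U (T - A) 0" .
  then have "singular_relboundary p U (T - A) c"
    unfolding homologous_rel_set_eq by (simp add: homologous_rel_def)
  then obtain e r where "singular_chain (Suc p) U e" "singular_chain p (subtopology U (T - A)) r"
    "chain_boundary (Suc p) e + r = c"
    unfolding singular_relboundary by blast
  moreover have "T - A = topspace U - L"
    by (auto simp: T_def)
  ultimately show ?thesis
    using that by metis
qed

lemma h_cycle:
  assumes "singular_relcycle p X A \<zeta>"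
  shows "homologous_rel p X A (chain_map p (h n) \<zeta>) \<zeta>"
proof -
  have "chain_map p id \<zeta> = \<zeta>"
    using assms by (intro chain_map_ident) (auto simp: singular_relcycle)
  then show ?thesis
    using homotopic_imp_homologous_rel_chain_maps[OF h_rel_A assms] by metis
qed

lemma h_continuous: "continuous_map X X (h n)"
  using h_rel_A homotopic_with_imp_continuous_maps by blast

lemma h_retract_cycle:
  assumes "singular_relcycle p X (topspace X - K (Suc n)) c"
  shows "singular_relcycle p X A (chain_map p (h n) c)"
    and "homologous_rel p X (topspace X - K n) (chain_map p (h n) c) c"
proof -
  show "singular_relcycle p X A (chain_map p (h n) c)"
    using singular_relcycle_chain_map[OF assms h_continuous h_squeeze] .
  have "chain_map p id c = c"
    using assms by (intro chain_map_ident) (auto simp: singular_relcycle)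
  then show "homologous_rel p X (topspace X - K n) (chain_map p (h n) c) c"
    using homotopic_imp_homologous_rel_chain_maps[OF h_rel_K assms] by metis
qed

text \<open>\<open>H\<^sub>p(X, A)\<close> is mapped injectively to \<open>H\<^sub>p(X, X - K (n + 1))\<close>, a left inverse being induced by \<open>h n\<close>.\<close>

lemma relboundary_descend:
  assumes \<zeta>: "singular_relcycle p X A \<zeta>" and "singular_relboundary p X (topspace X - K (Suc n)) \<zeta>"
  shows "singular_relboundary p X A \<zeta>"
proof -
  have "singular_relboundary p X A (chain_map p (h n) \<zeta>)"
    using singular_relboundary_chain_map[OF assms(2) h_continuous h_squeeze] .
  then have "homologous_rel p X A 0 (chain_map p (h n) \<zeta>)"
    by (simp add: homologous_rel_def singular_relboundary_minus)
  then have "homologous_rel p X A 0 \<zeta>"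
    using h_cycle[OF \<zeta>, of n] homologous_rel_trans by blast
  then show ?thesis
    by (metis diff_zero homologous_rel_def homologous_rel_sym)
qed

text \<open>An infinite sum of chains that move away from every compact set is a locally finite chain.\<close>

lemma series_lf_chain:
  assumes "singular_chain p U c" "\<And>n. singular_chain p (subtopology U (topspace U - K n)) (r n)"
  obtains w where "lf_chain p U w" "\<And>m. agree_on p (K m) w (c + (\<Sum>n<m. r n))"
proof -
  define w where "w \<sigma> = Poly_Mapping.lookup c \<sigma> +
      (\<Sum>n | Poly_Mapping.lookup (r n) \<sigma> \<noteq> 0. Poly_Mapping.lookup (r n) \<sigma>)" for \<sigma>
  have rn: "Poly_Mapping.lookup (r n) \<sigma> = 0" if "\<sigma> ` standard_simplex p \<inter> K m \<noteq> {}" "m \<le> n" for m n \<sigma>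
  proof -
    have "agree_on p (K n) (\<lambda>_. 0) (r n)"
      using agree_on_zero_iff[OF avoid_U(1)[OF assms(2)]] assms(2) by blast
    then show ?thesis
      using K_mono[OF that(2)] that(1) agree_onD by (metis agree_on_mono)
  qed
  have agree: "agree_on p (K m) w (c + (\<Sum>n<m. r n))" for m
    unfolding agree_on_def
  proof (intro allI impI)
    fix \<sigma> assume \<sigma>: "\<sigma> ` standard_simplex p \<inter> K m \<noteq> {}"
    have "{n. Poly_Mapping.lookup (r n) \<sigma> \<noteq> 0} \<subseteq> {..<m}"
      using rn[OF \<sigma>] by (auto simp: not_less[symmetric])
    then have "(\<Sum>n | Poly_Mapping.lookup (r n) \<sigma> \<noteq> 0. Poly_Mapping.lookup (r n) \<sigma>) =
        (\<Sum>n<m. Poly_Mapping.lookup (r n) \<sigma>)"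
      by (intro sum.mono_neutral_left) auto
    then show "w \<sigma> = Poly_Mapping.lookup (c + (\<Sum>n<m. r n)) \<sigma>"
      by (simp add: w_def lookup_add lookup_sum)
  qed
  moreover have "lf_chain p U w"
  proof (rule lf_chainI)
    show "singular_simplex p U \<sigma>" if "w \<sigma> \<noteq> 0" for \<sigma>
    proof (rule ccontr)
      assume non: "\<not> singular_simplex p U \<sigma>"
      have "Poly_Mapping.lookup d \<sigma> = 0" if "singular_chain p U d" for d
        using that non by (auto simp: singular_chain_def in_keys_iff)
      then show False
        using \<open>w \<sigma> \<noteq> 0\<close> assms(1) avoid_U(1)[OF assms(2)] by (simp add: w_def)
    qed
    fix L assume "compactin U L"
    then obtain m where "L \<subseteq> K m"
      using K_exhaust by blast
    then show "\<exists>d. agree_on p L w d"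
      using agree[of m] agree_on_mono by blast
  qed
  ultimately show ?thesis
    using that by blast
qed

lemma BM_related_diff:
  assumes "BM_related p X A \<zeta> w" "BM_related p X A \<zeta>' w'"
  shows "BM_related p X A (\<zeta> - \<zeta>') (\<lambda>\<sigma>. w \<sigma> - w' \<sigma>)"
  unfolding BM_related_def
proof (intro allI impI)
  fix L assume L: "compactin U L"
  obtain d where d: "singular_chain p U d" "agree_on p L w d" "homologous_rel p X (topspace X - L) \<zeta> d"
    using assms(1) L unfolding BM_related_def by blast
  obtain d' where d': "singular_chain p U d'" "agree_on p L w' d'" "homologous_rel p X (topspace X - L) \<zeta>' d'"
    using assms(2) L unfolding BM_related_def by blast
  have "agree_on p L (\<lambda>\<sigma>. w \<sigma> - w' \<sigma>) (d - d')"
    using d(2) d'(2) by (simp add: agree_on_def lookup_minus)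
  then show "\<exists>d. singular_chain p U d \<and> agree_on p L (\<lambda>\<sigma>. w \<sigma> - w' \<sigma>) d \<and>
      homologous_rel p X (topspace X - L) (\<zeta> - \<zeta>') d"
    using d d' by (intro exI[of _ "d - d'"]) (simp add: singular_chain_diff homologous_rel_diff)
qed

lemma BM_related_zero_right:
  assumes \<zeta>: "singular_relcycle p X A \<zeta>"
  shows "BM_related p X A \<zeta> (\<lambda>_. 0) \<longleftrightarrow> singular_relboundary p X A \<zeta>"
proof
  assume "BM_related p X A \<zeta> (\<lambda>_. 0)"
  then obtain d where d: "singular_chain p U d" "agree_on p (K 1) (\<lambda>_. 0) d"
    "homologous_rel p X (topspace X - K 1) \<zeta> d"
    using K_compact unfolding BM_related_def by blast
  have "singular_chain p (subtopology X (topspace X - K 1)) d"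
    using d(1,2) agree_on_zero_iff chain_U_imp by blast
  then have "homologous_rel p X (topspace X - K 1) d 0"
    by (intro homologous_rel_chain_diff) simp
  then have "homologous_rel p X (topspace X - K 1) \<zeta> 0"
    using d(3) homologous_rel_trans by blast
  then show "singular_relboundary p X A \<zeta>"
    using relboundary_descend[OF \<zeta>, of 0] by (simp add: homologous_rel_def)
next
  assume bd: "singular_relboundary p X A \<zeta>"
  have "homologous_rel p X (topspace X - L) \<zeta> 0" if "compactin U L" for L
    using singular_relboundary_subset[OF bd compact_avoids(4)[OF that]] by (simp add: homologous_rel_def)
  then show "BM_related p X A \<zeta> (\<lambda>_. 0)"
    unfolding BM_related_def by (intro allI impI exI[of _ 0]) (auto simp: agree_on_def)
qed

lemma BM_related_boundary:
  assumes E: "lf_chain (Suc p) U E"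
  shows "BM_related p X A 0 (lf_boundary (Suc p) E)"
  unfolding BM_related_def
proof (intro allI impI)
  fix L assume "compactin U L"
  then obtain e where e: "singular_chain (Suc p) U e" "agree_on (Suc p) L E e"
    using lf_chain_truncate[OF E] by blast
  have "singular_relboundary p X (topspace X - L) (chain_boundary (Suc p) e)"
    unfolding singular_relboundary using chain_U_imp[OF e(1)] by (metis add.right_neutral singular_chain_0)
  then have "homologous_rel p X (topspace X - L) 0 (chain_boundary (Suc p) e)"
    by (simp add: homologous_rel_def singular_relboundary_minus)
  then show "\<exists>d. singular_chain p U d \<and> agree_on p L (lf_boundary (Suc p) E) d \<and>
      homologous_rel p X (topspace X - L) 0 d"
    using agree_on_boundary[OF e(2)] singular_chain_boundary_alt[OF e(1)] by auto
qed

text \<open>This is where a \<open>lim\<^sup>1\<close> term could obstruct. By hypothesis \<open>w\<close> is, near each \<open>K (n + 1)\<close>, the boundary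
  of a finite chain \<open>e n\<close>. To add these up, \<open>e (n + 1) - e n\<close> should be homologous to a chain missing
  \<open>K n\<close>. It is a cycle relative to \<open>X - K (n + 1)\<close>, so by \<open>h n\<close> it comes, modulo \<open>X - K n\<close>, from a
  class of \<open>(X, A)\<close>; subtracting from \<open>e (n + 1)\<close> a chain representing this class modulo
  \<open>X - K (n + 2)\<close> achieves it without affecting the boundary near \<open>K (n + 2)\<close>.\<close>

lemma BM_related_zero_left:
  assumes w: "lf_chain p U w" and rel: "BM_related p X A 0 w"
  obtains E where "lf_chain (Suc p) U E" "w = lf_boundary (Suc p) E"
proof -
  \<comment> \<open>\<open>P\<close> refers to \<open>K (n + 1)\<close> and \<open>Q\<close> to \<open>K n\<close>, as one application of \<open>h n\<close> costs one step of the
    exhaustion.\<close>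
  define P where "P n e \<longleftrightarrow> singular_chain (Suc p) U e \<and>
      agree_on p (K (Suc n)) w (chain_boundary (Suc p) e)" for n e
  define Q where "Q n e e' \<longleftrightarrow> (\<exists>f r. singular_chain (Suc (Suc p)) U f \<and>
      singular_chain (Suc p) (subtopology U (topspace U - K n)) r \<and>
      e' - e = chain_boundary (Suc (Suc p)) f + r)" for n e e'
  have ex: "\<exists>e. P n e" for n
  proof -
    obtain d where d: "singular_chain p U d" "agree_on p (K (Suc n)) w d"
      "homologous_rel p X (topspace X - K (Suc n)) 0 d"
      using rel K_compact unfolding BM_related_def by blast
    have "singular_relboundary p X (topspace X - K (Suc n)) d"
      using d(3) by (simp add: homologous_rel_def singular_relboundary_minus)
    then obtain e r where er: "singular_chain (Suc p) U e"
      "singular_chain p (subtopology U (topspace U - K (Suc n))) r" "d = chain_boundary (Suc p) e + r"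
      using excise_boundary[OF K_compact d(1)] by metis
    have "agree_on p (K (Suc n)) (\<lambda>_. 0) r"
      using agree_on_zero_iff[OF avoid_U(1)[OF er(2)]] er(2) by blast
    then have "agree_on p (K (Suc n)) w (chain_boundary (Suc p) e)"
      using d(2) er(3) by (auto simp: agree_on_def lookup_add)
    then show ?thesis
      using er(1) by (auto simp: P_def)
  qed
  have step: "\<exists>e'. P (Suc n) e' \<and> Q n e e'" if "P n e" for n e
  proof -
    obtain e1 where e1: "P (Suc n) e1" using ex by blast
    define D where "D = e1 - e"
    have D: "singular_chain (Suc p) U D"
      using e1 \<open>P n e\<close> by (auto simp: P_def D_def singular_chain_diff)
    have "agree_on p (K (Suc n)) w (chain_boundary (Suc p) e1)"
      using e1 K_Suc agree_on_mono unfolding P_def by blast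
    then have "singular_chain p (subtopology U (topspace U - K (Suc n)))
        (chain_boundary (Suc p) e1 - chain_boundary (Suc p) e)"
      using e1 \<open>P n e\<close> unfolding P_def
      by (intro agree_on_diff_chain singular_chain_boundary_alt) auto
    then have "singular_relcycle (Suc p) X (topspace X - K (Suc n)) D"
      using chain_U_imp[OF D] avoid_U(2) by (simp add: singular_relcycle D_def chain_boundary_diff)
    note hD = h_retract_cycle[OF this]
    have "singular_relcycle (Suc p) X (topspace X - K (Suc (Suc n))) (chain_map (Suc p) (h n) D)"
      using singular_relcycle_subset[OF hD(1) compact_avoids(4)[OF K_compact]] .
    then obtain c where c: "singular_chain (Suc p) U c"
      "homologous_rel (Suc p) X (topspace X - K (Suc (Suc n))) (chain_map (Suc p) (h n) D) c"
      using excise_cycle[OF K_compact] by metis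
    have c_cyc: "singular_relcycle (Suc p) X (topspace X - K (Suc (Suc n))) c"
      using homologous_rel_singular_relcycle_1[OF c(2)]
        singular_relcycle_subset[OF hD(1) compact_avoids(4)[OF K_compact]] by blast
    have "agree_on p (K (Suc (Suc n))) (\<lambda>_. 0) (chain_boundary (Suc p) c)"
      using agree_on_zero_iff[of p X "chain_boundary (Suc p) c"] c_cyc singular_chain_boundary_alt
      by (auto simp: singular_relcycle)
    then have "P (Suc n) (e1 - c)"
      using e1 c(1) unfolding P_def
      by (auto simp: singular_chain_diff chain_boundary_diff agree_on_def lookup_minus)
    moreover have "Q n e (e1 - c)"
    proof -
      have "homologous_rel (Suc p) X (topspace X - K n) (chain_map (Suc p) (h n) D) c"
        using c(2) K_mono[of n "Suc (Suc n)"] by (elim homologous_rel_subset) auto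
      then have "singular_relboundary (Suc p) X (topspace X - K n) (D - c)"
        using hD(2) homologous_rel_trans homologous_rel_sym unfolding homologous_rel_def by metis
      then obtain f r where fr: "singular_chain (Suc (Suc p)) U f"
        "singular_chain (Suc p) (subtopology U (topspace U - K n)) r"
        "D - c = chain_boundary (Suc (Suc p)) f + r"
        by (rule excise_boundary[OF K_compact singular_chain_diff[OF D c(1)]])
      have "e1 - c - e = D - c"
        by (simp add: D_def)
      with fr show ?thesis
        unfolding Q_def by metis
    qed
    ultimately show ?thesis by blast
  qed
  obtain e where e: "\<And>n. P n (e n)" "\<And>n. Q n (e n) (e (Suc n))"
    using dependent_nat_choice[of P Q] ex step by metis
  obtain f r where fr: "\<And>n. singular_chain (Suc (Suc p)) U (f n)"
    "\<And>n. singular_chain (Suc p) (subtopology U (topspace U - K n)) (r n)"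
    "\<And>n. e (Suc n) - e n = chain_boundary (Suc (Suc p)) (f n) + r n"
    using e(2) unfolding Q_def by metis
  obtain E where E: "lf_chain (Suc p) U E" "\<And>m. agree_on (Suc p) (K m) E (e 0 + (\<Sum>n<m. r n))"
    using series_lf_chain[of "Suc p" "e 0" r] e(1) fr(2) unfolding P_def by blast
  have "e m = e 0 + (\<Sum>n<m. r n) + chain_boundary (Suc (Suc p)) (\<Sum>n<m. f n)" for m
  proof (induction m)
    case (Suc m)
    have "e (Suc m) = e m + (chain_boundary (Suc (Suc p)) (f m) + r m)"
      using fr(3)[of m] by (metis add.commute diff_add_cancel)
    then show ?case
      by (simp add: Suc chain_boundary_add algebra_simps)
  qed simp
  then have tele: "e 0 + (\<Sum>n<m. r n) = e m - chain_boundary (Suc (Suc p)) (\<Sum>n<m. f n)" for m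
    by (metis add_diff_cancel_right')
  have agree_E: "agree_on p (K m) (lf_boundary (Suc p) E) (chain_boundary (Suc p) (e m))" for m
  proof -
    have "chain_boundary (Suc p) (e 0 + (\<Sum>n<m. r n)) = chain_boundary (Suc p) (e m)"
      unfolding tele chain_boundary_diff
      using chain_boundary_boundary_alt[of "Suc p" U] singular_chain_sum[of "{..<m}" "Suc (Suc p)" U f] fr(1)
      by simp
    then show ?thesis
      using agree_on_boundary[OF E(2)[of m]] by simp
  qed
  have "w = lf_boundary (Suc p) E"
  proof (rule lf_chain_ext[of _ p U])
    show "singular_simplex p U \<sigma>" if "w \<sigma> \<noteq> 0" for \<sigma>
      using w that by (simp add: lf_chain_def)
    show "singular_simplex p U \<sigma>" if "lf_boundary (Suc p) E \<sigma> \<noteq> 0" for \<sigma>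
      using lf_boundary_support[OF E(1) that] by simp
    fix L assume "compactin U L"
    then obtain m where m: "L \<subseteq> K m" using K_exhaust by blast
    have "agree_on p L w (chain_boundary (Suc p) (e m))"
      using e(1)[of m] m K_Suc[of m] agree_on_mono unfolding P_def by blast
    moreover have "agree_on p L (lf_boundary (Suc p) E) (chain_boundary (Suc p) (e m))"
      using agree_E m agree_on_mono by blast
    ultimately show "\<exists>d. agree_on p L w d \<and> agree_on p L (lf_boundary (Suc p) E) d"
      by blast
  qed
  then show ?thesis
    using that E(1) by blast
qed

text \<open>Truncations \<open>d n\<close> of \<open>w\<close> are relative cycles modulo \<open>X - K n\<close>, and \<open>h n\<close> turns \<open>d (n + 1)\<close> into a
  cycle \<open>z n\<close> relative to \<open>A\<close> with the same class modulo \<open>X - K n\<close>. All \<open>z n\<close> with \<open>n \<ge> 1\<close> are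
  homologous relative to \<open>A\<close>, because they are so modulo \<open>X - K 1\<close>; hence \<open>z 1\<close> will do.\<close>

lemma BM_related_exists_cycle:
  assumes w: "lf_chain p U w" and cyc: "lf_boundary p w = (\<lambda>_. 0)"
  obtains \<zeta> where "singular_relcycle p X A \<zeta>" "BM_related p X A \<zeta> w"
proof -
  have "\<exists>d. singular_chain p U d \<and> agree_on p (K n) w d" for n
    using lf_chain_truncate[OF w K_compact] by metis
  then obtain d where d: "\<And>n. singular_chain p U (d n)" "\<And>n. agree_on p (K n) w (d n)"
    by metis
  have d_cyc: "singular_relcycle p X (topspace X - K n) (d n)" for n
  proof -
    have "agree_on (p - 1) (K n) (\<lambda>_. 0) (chain_boundary p (d n))"
      using agree_on_boundary[OF d(2)[of n]] cyc by simp
    then show ?thesis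
      using chain_U_imp[OF d(1)] agree_on_zero_iff[OF singular_chain_boundary[OF chain_U_imp[OF d(1)]]]
      by (simp add: singular_relcycle)
  qed
  have d_rel: "homologous_rel p X (topspace X - K m) (d n) (d m)" if "m \<le> n" for m n
  proof -
    have "agree_on p (K m) w (d n)"
      using agree_on_mono[OF d(2) K_mono[OF that]] .
    from agree_on_diff_chain[OF this d(2) d(1) d(1)]
    have "singular_chain p (subtopology U (topspace U - K m)) (d n - d m)" .
    then show ?thesis
      using avoid_U(2) homologous_rel_chain_diff by blast
  qed
  define z where "z n = chain_map p (h n) (d (Suc n))" for n
  have z: "singular_relcycle p X A (z n)" "homologous_rel p X (topspace X - K n) (z n) (d n)" for n
    using h_retract_cycle[OF d_cyc] d_rel[of n "Suc n"] homologous_rel_trans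
    unfolding z_def by (blast, metis le_SucI order_refl)
  have "BM_related p X A (z 1) w"
    unfolding BM_related_def
  proof (intro allI impI)
    fix L assume "compactin U L"
    then obtain n0 where "L \<subseteq> K n0" using K_exhaust by blast
    then obtain n where n: "L \<subseteq> K n" "1 \<le> n"
      using K_mono[of n0 "max 1 n0"] by (metis max.cobounded1 max.cobounded2 order_trans)
    have "homologous_rel p X (topspace X - K 1) (z n) (d n)"
      using z(2)[of n] K_mono[OF n(2)] by (elim homologous_rel_subset) auto
    then have "homologous_rel p X (topspace X - K 1) (z n) (z 1)"
      using d_rel[OF n(2)] z(2)[of 1] homologous_rel_trans homologous_rel_sym by metis
    then have "singular_relboundary p X A (z n - z 1)"
      using relboundary_descend[of p "z n - z 1" 0] z(1)
      by (simp add: homologous_rel_def singular_relcycle_diff)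
    then have "homologous_rel p X A (z 1) (z n)"
      by (metis homologous_rel_def homologous_rel_sym)
    then have "homologous_rel p X (topspace X - K n) (z 1) (d n)"
      using z(2)[of n] homologous_rel_subset[OF _ compact_avoids(4)[OF K_compact]] homologous_rel_trans
      by metis
    then have "homologous_rel p X (topspace X - L) (z 1) (d n)"
      using n(1) by (elim homologous_rel_subset) auto
    then show "\<exists>d. singular_chain p U d \<and> agree_on p L w d \<and> homologous_rel p X (topspace X - L) (z 1) d"
      using d agree_on_mono[OF d(2) n(1)] by blast
  qed
  then show ?thesis
    using that z(1) by blast
qed

text \<open>Excise \<open>\<zeta>\<close> to chains \<open>c n\<close> in \<open>U\<close>, homologous to it modulo \<open>X - K n\<close>. Then
  \<open>c (n + 1) - c n\<close> is a boundary plus a chain \<open>r n\<close> missing \<open>K n\<close>, and \<open>c 0 + r 0 + r 1 + \<dots>\<close> is the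
  locally finite cycle sought: up to boundaries, its partial sums are the \<open>c n\<close>.\<close>

lemma BM_related_exists_lf_cycle:
  assumes \<zeta>: "singular_relcycle p X A \<zeta>"
  obtains w where "lf_chain p U w" "lf_boundary p w = (\<lambda>_. 0)" "BM_related p X A \<zeta> w"
proof -
  have \<zeta>_n: "singular_relcycle p X (topspace X - K n) \<zeta>" for n
    using singular_relcycle_subset[OF \<zeta> compact_avoids(4)[OF K_compact]] .
  have "\<exists>c. singular_chain p U c \<and> homologous_rel p X (topspace X - K n) \<zeta> c" for n
    using excise_cycle[OF K_compact \<zeta>_n] by metis
  then obtain c where c: "\<And>n. singular_chain p U (c n)"
    "\<And>n. homologous_rel p X (topspace X - K n) \<zeta> (c n)"
    by metis
  have "\<exists>e r. singular_chain (Suc p) U e \<and> singular_chain p (subtopology U (topspace U - K n)) r \<and>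
      c (Suc n) - c n = chain_boundary (Suc p) e + r" for n
  proof -
    have "homologous_rel p X (topspace X - K n) \<zeta> (c (Suc n))"
      using c(2)[of "Suc n"] K_Suc[of n] by (elim homologous_rel_subset) auto
    then have "singular_relboundary p X (topspace X - K n) (c (Suc n) - c n)"
      using c(2)[of n] homologous_rel_trans homologous_rel_sym unfolding homologous_rel_def by metis
    from excise_boundary[OF K_compact singular_chain_diff[OF c(1) c(1)] this] show ?thesis
      by metis
  qed
  then obtain e r where er: "\<And>n. singular_chain (Suc p) U (e n)"
    "\<And>n. singular_chain p (subtopology U (topspace U - K n)) (r n)"
    "\<And>n. c (Suc n) - c n = chain_boundary (Suc p) (e n) + r n"
    by metis
  obtain w where w: "lf_chain p U w" "\<And>m. agree_on p (K m) w (c 0 + (\<Sum>n<m. r n))"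
    using series_lf_chain[of p "c 0" r] c(1) er(2) by blast
  have "c m = c 0 + (\<Sum>n<m. r n) + chain_boundary (Suc p) (\<Sum>n<m. e n)" for m
  proof (induction m)
    case (Suc m)
    have "c (Suc m) = c m + (chain_boundary (Suc p) (e m) + r m)"
      using er(3)[of m] by (metis add.commute diff_add_cancel)
    then show ?case
      by (simp add: Suc chain_boundary_add algebra_simps)
  qed simp
  then have tele: "c 0 + (\<Sum>n<m. r n) = c m - chain_boundary (Suc p) (\<Sum>n<m. e n)" for m
    by (metis add_diff_cancel_right')
  have e_sum: "singular_chain (Suc p) U (\<Sum>n<m. e n)" for m
    using er(1) by (intro singular_chain_sum)
  have w_chain: "singular_chain p U (c 0 + (\<Sum>n<m. r n))" for m
    unfolding tele using c(1) e_sum by (intro singular_chain_diff singular_chain_boundary_alt)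
  have "lf_boundary p w = (\<lambda>_. 0)"
  proof (rule lf_chain_ext[of _ "p - 1" U])
    show "singular_simplex (p - 1) U \<tau>" if "lf_boundary p w \<tau> \<noteq> 0" for \<tau>
      using lf_boundary_support[OF w(1) that] .
    fix L assume "compactin U L"
    then obtain m where m: "L \<subseteq> K m" using K_exhaust by blast
    have "chain_boundary p (c 0 + (\<Sum>n<m. r n)) = chain_boundary p (c m)"
      unfolding tele chain_boundary_diff using chain_boundary_boundary_alt[OF e_sum] by simp
    then have "agree_on (p - 1) (K m) (lf_boundary p w) (chain_boundary p (c m))"
      using agree_on_boundary[OF w(2)[of m]] by simp
    moreover have "singular_relcycle p X (topspace X - K m) (c m)"
      using homologous_rel_singular_relcycle_1[OF c(2) \<zeta>_n] .
    then have "agree_on (p - 1) (K m) (\<lambda>_. 0) (chain_boundary p (c m))"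
      using agree_on_zero_iff[OF singular_chain_boundary[OF chain_U_imp[OF c(1)]]]
      by (simp add: singular_relcycle)
    ultimately show "\<exists>d. agree_on (p - 1) L (lf_boundary p w) d \<and> agree_on (p - 1) L (\<lambda>_. 0) d"
      using agree_on_mono[OF _ m] by blast
  qed simp
  moreover have "BM_related p X A \<zeta> w"
    unfolding BM_related_def
  proof (intro allI impI)
    fix L assume "compactin U L"
    then obtain m where m: "L \<subseteq> K m" using K_exhaust by blast
    have "singular_relboundary p X (topspace X - K m) (chain_boundary (Suc p) (\<Sum>n<m. e n))"
      unfolding singular_relboundary using chain_U_imp[OF e_sum] by (metis add.right_neutral singular_chain_0)
    then have "homologous_rel p X (topspace X - K m) (c m) (c 0 + (\<Sum>n<m. r n))"
      unfolding tele homologous_rel_def by simp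
    then have "homologous_rel p X (topspace X - K m) \<zeta> (c 0 + (\<Sum>n<m. r n))"
      using c(2) homologous_rel_trans by blast
    then have "homologous_rel p X (topspace X - L) \<zeta> (c 0 + (\<Sum>n<m. r n))"
      using m by (elim homologous_rel_subset) auto
    then show "\<exists>d. singular_chain p U d \<and> agree_on p L w d \<and> homologous_rel p X (topspace X - L) \<zeta> d"
      using w_chain agree_on_mono[OF w(2) m] by blast
  qed
  ultimately show ?thesis
    using that w(1) by blast
qed

end

text \<open>Compact subsets of \<open>U\<close> are permuted by the homeomorphism, so the defining condition for \<open>L\<close> follows
  from the one for \<open>g ` L\<close>.\<close>

lemma BM_related_natural:
  assumes fg: "homeomorphic_maps X X f g" and fA: "f \<in> A \<rightarrow> A" and gA: "g \<in> A \<rightarrow> A"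
    and w: "lf_chain p (subtopology X (topspace X - A)) w" and rel: "BM_related p X A \<zeta> w"
  shows "homeomorphic_maps (subtopology X (topspace X - A)) (subtopology X (topspace X - A)) f g"
    and "BM_related p X A (chain_map p f \<zeta>) (lf_chain_map p f w)"
proof -
  let ?U = "subtopology X (topspace X - A)"
  have fg': "continuous_map X X f" "continuous_map X X g"
    "\<And>x. x \<in> topspace X \<Longrightarrow> g (f x) = x" "\<And>x. x \<in> topspace X \<Longrightarrow> f (g x) = x"
    using fg by (auto simp: homeomorphic_maps_def)
  have f_top: "f x \<in> topspace X" "g x \<in> topspace X" if "x \<in> topspace X" for x
    using fg'(1,2) that by (auto simp: continuous_map_def)
  have fU: "f x \<in> topspace X - A" "g x \<in> topspace X - A" if "x \<in> topspace X - A" for x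
    using that f_top[of x] fg'(3,4)[of x] fA gA by (auto, (metis PiE)+)
  show U: "homeomorphic_maps ?U ?U f g"
    using fg' fU by (auto simp: homeomorphic_maps_def continuous_map_in_subtopology
        continuous_map_from_subtopology)
  show "BM_related p X A (chain_map p f \<zeta>) (lf_chain_map p f w)"
    unfolding BM_related_def
  proof (intro allI impI)
    fix L assume L: "compactin ?U L"
    have gL: "compactin ?U (g ` L)"
      using U L image_compactin by (auto simp: homeomorphic_maps_def)
    obtain d where d: "singular_chain p ?U d" "agree_on p (g ` L) w d"
      "homologous_rel p X (topspace X - g ` L) \<zeta> d"
      using rel gL unfolding BM_related_def by blast
    have "f \<in> (topspace X - g ` L) \<rightarrow> (topspace X - L)"
    proof
      fix x assume "x \<in> topspace X - g ` L"
      then show "f x \<in> topspace X - L"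
        using f_top(1)[of x] fg'(3)[of x] by (auto, metis image_eqI)
    qed
    then have "homologous_rel p X (topspace X - L) (chain_map p f \<zeta>) (chain_map p f d)"
      using singular_relboundary_chain_map[OF d(3)[unfolded homologous_rel_def] fg'(1)]
      by (simp add: homologous_rel_def chain_map_diff)
    moreover have "singular_chain p ?U (chain_map p f d)"
      using singular_chain_chain_map[OF d(1)] U by (auto simp: homeomorphic_maps_def)
    ultimately show "\<exists>d. singular_chain p ?U d \<and> agree_on p L (lf_chain_map p f w) d \<and>
        homologous_rel p X (topspace X - L) (chain_map p f \<zeta>) d"
      using agree_on_chain_map[OF U w d(1,2)] by blast
  qed
qed

section \<open>The comparison isomorphism\<close>

lemma lf_cycle_group_simps [simp]:
  "carrier (lf_cycle_group p X) = {c. lf_chain p X c \<and> lf_boundary p c = (\<lambda>_. 0)}"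
  "c \<otimes>\<^bsub>lf_cycle_group p X\<^esub> d = (\<lambda>\<sigma>. c \<sigma> + d \<sigma>)"
  "\<one>\<^bsub>lf_cycle_group p X\<^esub> = (\<lambda>_. 0)"
  by (simp_all add: lf_cycle_group_def)

lemma comm_group_lf_cycle_group: "comm_group (lf_cycle_group p X)"
proof (rule comm_groupI)
  show "\<exists>y\<in>carrier (lf_cycle_group p X). y \<otimes>\<^bsub>lf_cycle_group p X\<^esub> x = \<one>\<^bsub>lf_cycle_group p X\<^esub>"
    if "x \<in> carrier (lf_cycle_group p X)" for x
    using that by (intro bexI[of _ "\<lambda>\<sigma>. - x \<sigma>"]) (auto simp: lf_chain_minus lf_boundary_minus)
qed (auto simp: lf_chain_add lf_boundary_add lf_chain_zero algebra_simps)

lemma lf_boundary_set_subset: "lf_boundary_set p X \<subseteq> carrier (lf_cycle_group p X)"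
  using lf_chain_boundary[of "Suc p" X] lf_boundary_boundary[of "Suc p" X]
  by (auto simp: lf_boundary_set_def)

lemma subgroup_lf_boundary_set: "subgroup (lf_boundary_set p X) (lf_cycle_group p X)"
proof -
  interpret comm_group "lf_cycle_group p X" by (rule comm_group_lf_cycle_group)
  show ?thesis
  proof (rule subgroupI[OF lf_boundary_set_subset])
    have "(\<lambda>_. 0) \<in> lf_boundary_set p X"
      unfolding lf_boundary_set_def by (rule image_eqI[of _ _ "\<lambda>_. 0"]) (auto simp: lf_chain_zero)
    then show "lf_boundary_set p X \<noteq> {}" by blast
  next
    fix a assume a: "a \<in> lf_boundary_set p X"
    then obtain E where E: "lf_chain (Suc p) X E" "a = lf_boundary (Suc p) E"
      by (auto simp: lf_boundary_set_def)
    have neg: "(\<lambda>\<sigma>. - a \<sigma>) \<in> lf_boundary_set p X"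
      unfolding lf_boundary_set_def using E
      by (intro image_eqI[of _ _ "\<lambda>\<sigma>. - E \<sigma>"]) (auto simp: lf_chain_minus lf_boundary_minus)
    have "inv\<^bsub>lf_cycle_group p X\<^esub> a = (\<lambda>\<sigma>. - a \<sigma>)"
      using a neg lf_boundary_set_subset by (intro inv_equality) auto
    then show "inv\<^bsub>lf_cycle_group p X\<^esub> a \<in> lf_boundary_set p X"
      using neg by simp
  next
    fix a b assume "a \<in> lf_boundary_set p X" "b \<in> lf_boundary_set p X"
    then obtain E F where "lf_chain (Suc p) X E" "a = lf_boundary (Suc p) E"
      "lf_chain (Suc p) X F" "b = lf_boundary (Suc p) F"
      by (auto simp: lf_boundary_set_def)
    then show "a \<otimes>\<^bsub>lf_cycle_group p X\<^esub> b \<in> lf_boundary_set p X"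
      unfolding lf_boundary_set_def
      by (intro image_eqI[of _ _ "\<lambda>\<sigma>. E \<sigma> + F \<sigma>"]) (auto simp: lf_boundary_add lf_chain_add)
  qed
qed

lemma comm_group_BM_homology_group: "comm_group (BM_homology_group p X)"
  unfolding BM_homology_group_def
  by (intro comm_group.abelian_FactGroup comm_group_lf_cycle_group subgroup_lf_boundary_set)

definition BM_class :: "nat \<Rightarrow> 'a topology \<Rightarrow> 'a lf_chain \<Rightarrow> 'a lf_chain set" where
  "BM_class p X w = lf_boundary_set p X #>\<^bsub>lf_cycle_group p X\<^esub> w"

lemma mem_BM_class: "v \<in> BM_class p X w \<longleftrightarrow> (\<exists>b\<in>lf_boundary_set p X. v = (\<lambda>\<sigma>. b \<sigma> + w \<sigma>))"
  by (auto simp: BM_class_def r_coset_def)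

lemma carrier_BM_homology_group:
  "carrier (BM_homology_group p X) =
     BM_class p X ` {w. lf_chain p X w \<and> lf_boundary p w = (\<lambda>_. 0)}"
  by (auto simp: BM_homology_group_def carrier_FactGroup BM_class_def)

lemma mult_BM_class:
  assumes "lf_chain p X v" "lf_boundary p v = (\<lambda>_. 0)" "lf_chain p X w" "lf_boundary p w = (\<lambda>_. 0)"
  shows "BM_class p X v \<otimes>\<^bsub>BM_homology_group p X\<^esub> BM_class p X w = BM_class p X (\<lambda>\<sigma>. v \<sigma> + w \<sigma>)"
proof -
  have "lf_boundary_set p X \<lhd> lf_cycle_group p X"
    using comm_group.normal_iff_subgroup comm_group_lf_cycle_group subgroup_lf_boundary_set by blast
  from normal.rcos_sum[OF this, of v w] assms show ?thesis
    by (simp add: BM_homology_group_def BM_class_def)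
qed

lemma BM_class_eqI:
  assumes "lf_chain p X v" "lf_boundary p v = (\<lambda>_. 0)" "lf_chain p X w" "lf_boundary p w = (\<lambda>_. 0)"
    and "(\<lambda>\<sigma>. v \<sigma> - w \<sigma>) \<in> lf_boundary_set p X"
  shows "BM_class p X v = BM_class p X w"
proof -
  interpret comm_group "lf_cycle_group p X" by (rule comm_group_lf_cycle_group)
  have "v \<in> BM_class p X w"
    using assms(5) unfolding mem_BM_class by (intro bexI) auto
  then show ?thesis
    using repr_independence[OF _ _ subgroup_lf_boundary_set, of v w] assms(3,4)
    unfolding BM_class_def by simp
qed

lemma BM_induced_class:
  assumes fg: "homeomorphic_maps U V f g"
    and w: "lf_chain p U w" "lf_boundary p w = (\<lambda>_. 0)"
  shows "BM_induced p V f (BM_class p U w) = BM_class p V (lf_chain_map p f w)"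
    and "lf_chain p V (lf_chain_map p f w)" "lf_boundary p (lf_chain_map p f w) = (\<lambda>_. 0)"
proof -
  interpret comm_group "lf_cycle_group p V" by (rule comm_group_lf_cycle_group)
  show "lf_chain p V (lf_chain_map p f w)"
    using lf_chain_chain_map[OF fg w(1)] .
  show "lf_boundary p (lf_chain_map p f w) = (\<lambda>_. 0)"
    using lf_boundary_chain_map[OF fg w(1)] w(2) by (simp add: lf_chain_map_def lf_extend_def)
  have bd: "lf_chain_map p f b \<in> lf_boundary_set p V" if b: "b \<in> lf_boundary_set p U" for b
  proof -
    obtain E where E: "lf_chain (Suc p) U E" "b = lf_boundary (Suc p) E"
      using b by (auto simp: lf_boundary_set_def)
    show ?thesis
      unfolding lf_boundary_set_def using E lf_boundary_chain_map[OF fg E(1)] lf_chain_chain_map[OF fg E(1)]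
      by (intro image_eqI[of _ _ "lf_chain_map (Suc p) f E"]) auto
  qed
  have add: "lf_chain_map p f (\<lambda>\<sigma>. b \<sigma> + w \<sigma>) = (\<lambda>\<tau>. lf_chain_map p f b \<tau> + lf_chain_map p f w \<tau>)"
    if "b \<in> lf_boundary_set p U" for b
    using that lf_boundary_set_subset[of p U] by (intro lf_chain_map_add[OF fg] w) auto
  show "BM_induced p V f (BM_class p U w) = BM_class p V (lf_chain_map p f w)"
  proof (intro subset_antisym subsetI)
    fix v assume "v \<in> BM_induced p V f (BM_class p U w)"
    then obtain b b' where b: "b \<in> lf_boundary_set p V" "b' \<in> lf_boundary_set p U"
      "v = (\<lambda>\<sigma>. b \<sigma> + lf_chain_map p f (\<lambda>\<sigma>. b' \<sigma> + w \<sigma>) \<sigma>)"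
      by (auto simp: BM_induced_def set_mult_def mem_BM_class)
    have "(\<lambda>\<sigma>. b \<sigma> + lf_chain_map p f b' \<sigma>) \<in> lf_boundary_set p V"
      using subgroup.m_closed[OF subgroup_lf_boundary_set b(1) bd[OF b(2)]] by simp
    then show "v \<in> BM_class p V (lf_chain_map p f w)"
      unfolding mem_BM_class b(3) add[OF b(2)] by (intro bexI) (auto simp: add.assoc)
  next
    fix v assume "v \<in> BM_class p V (lf_chain_map p f w)"
    then obtain b where b: "b \<in> lf_boundary_set p V" "v = (\<lambda>\<sigma>. b \<sigma> + lf_chain_map p f w \<sigma>)"
      by (auto simp: mem_BM_class)
    have "w \<in> BM_class p U w"
      unfolding mem_BM_class using subgroup.one_closed[OF subgroup_lf_boundary_set[of p U]]
      by (intro bexI[of _ "\<lambda>_. 0"]) auto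
    then show "v \<in> BM_induced p V f (BM_class p U w)"
      using b by (auto simp: BM_induced_def set_mult_def)
  qed
qed

lemma mult_homologous_rel_set:
  assumes "singular_relcycle p X A a" "singular_relcycle p X A b"
  shows "homologous_rel_set p X A a \<otimes>\<^bsub>relative_homology_group (int p) X A\<^esub> homologous_rel_set p X A b
       = homologous_rel_set p X A (a + b)"
  using normal.rcos_sum[OF normal_subgroup_singular_relboundary_relcycle[of p X A], of a b] assms
  by (simp add: relative_homology_group_def right_coset_singular_relboundary)

text \<open>On the level of classes the relation \<open>BM_related\<close> is a map, given without choosing
  representatives.\<close>

definition comparison :: "nat \<Rightarrow> 'a topology \<Rightarrow> 'a set \<Rightarrow> 'a lf_chain set \<Rightarrow> 'a chain set" where
  "comparison p X A W = {\<zeta>. singular_relcycle p X A \<zeta> \<and> (\<exists>w\<in>W. BM_related p X A \<zeta> w)}"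

context tame_pair
begin

lemma comparison_class:
  assumes \<zeta>: "singular_relcycle p X A \<zeta>" and rel: "BM_related p X A \<zeta> w"
  shows "comparison p X A (BM_class p U w) = homologous_rel_set p X A \<zeta>"
proof (intro subset_antisym subsetI)
  fix \<zeta>' assume "\<zeta>' \<in> comparison p X A (BM_class p U w)"
  then obtain E where E: "singular_relcycle p X A \<zeta>'" "lf_chain (Suc p) U E"
    "BM_related p X A \<zeta>' (\<lambda>\<sigma>. lf_boundary (Suc p) E \<sigma> + w \<sigma>)"
    by (auto simp: comparison_def mem_BM_class lf_boundary_set_def)
  have "BM_related p X A \<zeta>' w"
    using BM_related_diff[OF E(3) BM_related_boundary[OF E(2)]] by simp
  from BM_related_diff[OF rel this] have "BM_related p X A (\<zeta> - \<zeta>') (\<lambda>_. 0)"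
    by simp
  then show "\<zeta>' \<in> homologous_rel_set p X A \<zeta>"
    using BM_related_zero_right[OF singular_relcycle_diff[OF \<zeta> E(1)]] by (simp add: homologous_rel_def)
next
  fix \<zeta>' assume "\<zeta>' \<in> homologous_rel_set p X A \<zeta>"
  then have hom: "homologous_rel p X A \<zeta> \<zeta>'" by simp
  then have \<zeta>': "singular_relcycle p X A \<zeta>'"
    using homologous_rel_singular_relcycle \<zeta> by blast
  have "BM_related p X A (\<zeta> - \<zeta>') (\<lambda>_. 0)"
    using hom BM_related_zero_right[OF singular_relcycle_diff[OF \<zeta> \<zeta>']] by (simp add: homologous_rel_def)
  from BM_related_diff[OF rel this] have "BM_related p X A \<zeta>' w"
    by simp
  moreover have "w \<in> BM_class p U w"
    unfolding mem_BM_class using subgroup.one_closed[OF subgroup_lf_boundary_set[of p U]]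
    by (intro bexI[of _ "\<lambda>_. 0"]) auto
  ultimately show "\<zeta>' \<in> comparison p X A (BM_class p U w)"
    using \<zeta>' by (auto simp: comparison_def)
qed

lemma BM_class_cases:
  assumes "S \<in> carrier (BM_homology_group p U)"
  obtains w \<zeta> where "S = BM_class p U w" "lf_chain p U w" "lf_boundary p w = (\<lambda>_. 0)"
    "singular_relcycle p X A \<zeta>" "BM_related p X A \<zeta> w"
    "comparison p X A S = homologous_rel_set p X A \<zeta>"
proof -
  obtain w where w: "S = BM_class p U w" "lf_chain p U w" "lf_boundary p w = (\<lambda>_. 0)"
    using assms unfolding carrier_BM_homology_group by blast
  obtain \<zeta> where "singular_relcycle p X A \<zeta>" "BM_related p X A \<zeta> w"
    using BM_related_exists_cycle[OF w(2,3)] .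
  then show ?thesis
    using that w comparison_class by blast
qed

theorem comparison_iso:
  "comparison p X A \<in> iso (BM_homology_group p U) (relative_homology_group (int p) X A)"
proof -
  have "comparison p X A \<in> hom (BM_homology_group p U) (relative_homology_group (int p) X A)"
  proof (rule homI)
    show "comparison p X A S \<in> carrier (relative_homology_group (int p) X A)"
      if "S \<in> carrier (BM_homology_group p U)" for S
      by (rule BM_class_cases[OF that]) (auto simp: carrier_relative_homology_group)
    fix S T assume S: "S \<in> carrier (BM_homology_group p U)" and T: "T \<in> carrier (BM_homology_group p U)"
    obtain v \<zeta> where v: "S = BM_class p U v" "lf_chain p U v" "lf_boundary p v = (\<lambda>_. 0)"
      "singular_relcycle p X A \<zeta>" "BM_related p X A \<zeta> v"
      "comparison p X A S = homologous_rel_set p X A \<zeta>"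
      by (rule BM_class_cases[OF S])
    obtain w \<xi> where w: "T = BM_class p U w" "lf_chain p U w" "lf_boundary p w = (\<lambda>_. 0)"
      "singular_relcycle p X A \<xi>" "BM_related p X A \<xi> w"
      "comparison p X A T = homologous_rel_set p X A \<xi>"
      by (rule BM_class_cases[OF T])
    have "BM_related p X A 0 (\<lambda>_. 0)"
      using BM_related_zero_right[of p 0] by simp
    from BM_related_diff[OF v(5) BM_related_diff[OF this w(5)]]
    have "BM_related p X A (\<zeta> + \<xi>) (\<lambda>\<sigma>. v \<sigma> + w \<sigma>)"
      by simp
    then have "comparison p X A (BM_class p U (\<lambda>\<sigma>. v \<sigma> + w \<sigma>)) = homologous_rel_set p X A (\<zeta> + \<xi>)"
      by (intro comparison_class singular_relcycle_add v w)
    then show "comparison p X A (S \<otimes>\<^bsub>BM_homology_group p U\<^esub> T) =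
        comparison p X A S \<otimes>\<^bsub>relative_homology_group (int p) X A\<^esub> comparison p X A T"
      using mult_BM_class[OF v(2,3) w(2,3)] mult_homologous_rel_set[OF v(4) w(4)]
      unfolding v(6) w(6) by (simp add: v(1) w(1))
  qed
  moreover have "inj_on (comparison p X A) (carrier (BM_homology_group p U))"
  proof (rule inj_onI)
    fix S T assume S: "S \<in> carrier (BM_homology_group p U)" and T: "T \<in> carrier (BM_homology_group p U)"
      and eq: "comparison p X A S = comparison p X A T"
    obtain v \<zeta> where v: "S = BM_class p U v" "lf_chain p U v" "lf_boundary p v = (\<lambda>_. 0)"
      "singular_relcycle p X A \<zeta>" "BM_related p X A \<zeta> v"
      "comparison p X A S = homologous_rel_set p X A \<zeta>"
      by (rule BM_class_cases[OF S])
    obtain w \<xi> where w: "T = BM_class p U w" "lf_chain p U w" "lf_boundary p w = (\<lambda>_. 0)"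
      "singular_relcycle p X A \<xi>" "BM_related p X A \<xi> w"
      "comparison p X A T = homologous_rel_set p X A \<xi>"
      by (rule BM_class_cases[OF T])
    have "singular_relboundary p X A (\<zeta> - \<xi>)"
      using eq unfolding v(6) w(6) homologous_rel_set_eq by (simp add: homologous_rel_def)
    then have "BM_related p X A (\<zeta> - \<xi>) (\<lambda>_. 0)"
      using BM_related_zero_right[OF singular_relcycle_diff[OF v(4) w(4)]] by simp
    from BM_related_diff[OF BM_related_diff[OF v(5) w(5)] this]
    have rel0: "BM_related p X A 0 (\<lambda>\<sigma>. v \<sigma> - w \<sigma>)"
      by simp
    have "lf_chain p U (\<lambda>\<sigma>. v \<sigma> - w \<sigma>)"
      using lf_chain_add[OF v(2) lf_chain_minus[OF w(2)]] by simp
    then have "(\<lambda>\<sigma>. v \<sigma> - w \<sigma>) \<in> lf_boundary_set p U"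
      by (rule BM_related_zero_left[OF _ rel0]) (auto simp: lf_boundary_set_def)
    then show "S = T"
      using BM_class_eqI[OF v(2,3) w(2,3)] v(1) w(1) by simp
  qed
  moreover have "carrier (relative_homology_group (int p) X A) \<subseteq>
      comparison p X A ` carrier (BM_homology_group p U)"
  proof
    fix Z assume "Z \<in> carrier (relative_homology_group (int p) X A)"
    then obtain \<zeta> where \<zeta>: "Z = homologous_rel_set p X A \<zeta>" "singular_relcycle p X A \<zeta>"
      by (auto simp: carrier_relative_homology_group)
    obtain w where w: "lf_chain p U w" "lf_boundary p w = (\<lambda>_. 0)" "BM_related p X A \<zeta> w"
      using BM_related_exists_lf_cycle[OF \<zeta>(2)] .
    show "Z \<in> comparison p X A ` carrier (BM_homology_group p U)"
      unfolding \<zeta>(1) comparison_class[OF \<zeta>(2) w(3), symmetric] carrier_BM_homology_group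
      using w by blast
  qed
  ultimately show ?thesis
    by (auto simp: iso_def bij_betw_def hom_def)
qed

theorem comparison_natural:
  assumes fg: "homeomorphic_maps X X f g" and fA: "f \<in> A \<rightarrow> A" and gA: "g \<in> A \<rightarrow> A"
    and S: "S \<in> carrier (BM_homology_group p U)"
  shows "BM_induced p U f S \<in> carrier (BM_homology_group p U)"
    and "comparison p X A (BM_induced p U f S) = hom_induced (int p) X A X A f (comparison p X A S)"
proof -
  obtain w \<zeta> where w: "S = BM_class p U w" "lf_chain p U w" "lf_boundary p w = (\<lambda>_. 0)"
    "singular_relcycle p X A \<zeta>" "BM_related p X A \<zeta> w"
    "comparison p X A S = homologous_rel_set p X A \<zeta>"
    by (rule BM_class_cases[OF S])
  note nat = BM_related_natural[OF fg fA gA w(2,5)]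
  note ind = BM_induced_class[OF nat(1) w(2,3)]
  have cont: "continuous_map X X f"
    using fg by (simp add: homeomorphic_maps_def)
  show "BM_induced p U f S \<in> carrier (BM_homology_group p U)"
    unfolding w(1) ind(1) carrier_BM_homology_group using ind(2,3) by blast
  have "comparison p X A (BM_induced p U f S) = homologous_rel_set p X A (chain_map p f \<zeta>)"
    unfolding w(1) ind(1)
    using comparison_class[OF singular_relcycle_chain_map[OF w(4) cont fA] nat(2)] .
  then show "comparison p X A (BM_induced p U f S) = hom_induced (int p) X A X A f (comparison p X A S)"
    unfolding w(6) using hom_induced_chain_map[OF cont fA w(4)] by simp
qed

end

section \<open>Compact pairs of absolute neighbourhood retracts are tame\<close>

text \<open>The exhaustion starts from the sets of points whose distance to \<open>A\<close> is at least \<open>1 / (n + 1)\<close>.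
  Each next compact set is enlarged so that a deformation from \<open>neighbourhood_squeeze\<close> moves its
  complement into \<open>A\<close>.\<close>

lemma tame_pair_exists:
  fixes X A :: "'a::euclidean_space set"
  assumes X: "ANR X" "compact X" and A: "ANR A" "closed A" "A \<subseteq> X" "A \<noteq> {}"
  shows "\<exists>K h. tame_pair (top_of_set X) A K h"
proof -
  have clo: "closedin (top_of_set X) A"
    using A closed_subset by blast
  have cpt: "compactin (subtopology (top_of_set X) (topspace (top_of_set X) - A)) L \<longleftrightarrow>
      compact L \<and> L \<subseteq> X - A" for L
    by (auto simp: compactin_subtopology)
  define B where "B n = {x \<in> X. 1 / (real n + 1) \<le> infdist x A}" for n :: nat
  have B_cpt: "compact (B n)" and B_sub: "B n \<subseteq> X - A" for n
  proof -
    have "closed {x. 1 / (real n + 1) \<le> infdist x A}"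
      by (intro closed_Collect_le continuous_intros)
    then have "compact (X \<inter> {x. 1 / (real n + 1) \<le> infdist x A})"
      using X(2) by (rule compact_Int_closed[rotated])
    then show "compact (B n)"
      by (simp add: B_def Collect_conj_eq)
    show "B n \<subseteq> X - A"
      by (auto simp: B_def)
  qed
  have B_exhaust: "\<exists>n. L \<subseteq> B n" if L: "compact L" "L \<subseteq> X - A" for L
  proof -
    obtain \<delta> where \<delta>: "\<delta> > 0" "\<And>x y. \<lbrakk>x \<in> L; y \<in> A\<rbrakk> \<Longrightarrow> \<delta> \<le> dist x y"
      using separate_compact_closed[OF L(1) A(2)] L(2) by blast
    obtain n where n: "1 / (real n + 1) < \<delta>"
      using \<delta>(1) by (metis add.commute nat_approx_posE of_nat_Suc)
    have "L \<subseteq> B n"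
    proof
      fix x assume x: "x \<in> L"
      then have "\<delta> \<le> infdist x A"
        using \<delta>(2) A(4) by (simp add: infdist_def cINF_greatest)
      then show "x \<in> B n"
        using n x L(2) by (auto simp: B_def)
    qed
    then show ?thesis ..
  qed
  define P where "P n K \<longleftrightarrow> compact K \<and> K \<subseteq> X - A \<and> B n \<subseteq> K" for n K
  define S where "S K K' h \<longleftrightarrow> K \<subseteq> K' \<and> h \<in> (X - K') \<rightarrow> A \<and>
      homotopic_with (\<lambda>f. f \<in> A \<rightarrow> A) (top_of_set X) (top_of_set X) h id \<and>
      homotopic_with (\<lambda>f. f \<in> (X - K') \<rightarrow> (X - K)) (top_of_set X) (top_of_set X) h id"
    for K K' and h :: "'a \<Rightarrow> 'a"
  have step: "\<exists>K'. P (Suc n) K' \<and> (\<exists>h. S K K' h)" if P: "P n K" for n K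
  proof -
    have K: "compact K" "K \<subseteq> X - A"
      using P by (auto simp: P_def)
    have V: "openin (top_of_set X) (X - K)" "A \<subseteq> X - K"
      using K A(3) closed_subset[OF _ compact_imp_closed[OF K(1)], of X]
      by (auto intro: openin_diff openin_subtopology_self)
    obtain N H where N: "openin (top_of_set X) N" "A \<subseteq> N"
      and H: "continuous_on ({0..1::real} \<times> X) H" "H \<in> {0..1} \<times> X \<rightarrow> X"
      "\<And>x. x \<in> X \<Longrightarrow> H (0, x) = x" "\<And>t a. a \<in> A \<Longrightarrow> t \<in> {0..1} \<Longrightarrow> H (t, a) = a"
      "\<And>t x. x \<in> N \<Longrightarrow> t \<in> {0..1} \<Longrightarrow> H (t, x) \<in> X - K" "\<And>x. x \<in> N \<Longrightarrow> H (1, x) \<in> A"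
      by (rule neighbourhood_squeeze[OF X(1) A(1) clo V]) blast
    define K' where "K' = K \<union> B (Suc n) \<union> (X - N)"
    have "closedin (top_of_set X) (X - N)"
      using N(1) by (metis closedin_diff closedin_topspace topspace_euclidean_subtopology)
    then have "compact (X - N)"
      using X(2) closedin_compact by blast
    then have "P (Suc n) K'"
      using K B_cpt B_sub N(2) by (auto simp: P_def K'_def)
    moreover have "S K K' (\<lambda>x. H (1, x))"
    proof -
      have cont: "continuous_map (prod_topology (top_of_set {0..1}) (top_of_set X)) (top_of_set X) H"
        using H(1,2) by (auto simp: prod_topology_subtopology_eu continuous_map_in_subtopology
            continuous_map_iff_continuous image_subset_iff_funcset)
      have htp: "homotopic_with (\<lambda>f. f \<in> R \<rightarrow> T) (top_of_set X) (top_of_set X) (\<lambda>x. H (1, x)) id"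
        if "R \<subseteq> X" "\<And>t x. t \<in> {0..1} \<Longrightarrow> x \<in> R \<Longrightarrow> H (t, x) \<in> T" for R T
      proof -
        have "homotopic_with (\<lambda>f. f \<in> R \<rightarrow> T) (top_of_set X) (top_of_set X) id (\<lambda>x. H (1, x))"
        proof (subst homotopic_with)
          show "(f \<in> R \<rightarrow> T) \<longleftrightarrow> (k \<in> R \<rightarrow> T)" if "\<And>x. x \<in> topspace (top_of_set X) \<Longrightarrow> f x = k x" for f k
            using that \<open>R \<subseteq> X\<close> by (auto simp: Pi_iff subset_iff)
          show "\<exists>h. continuous_map (prod_topology (top_of_set {0..1::real}) (top_of_set X)) (top_of_set X) h \<and>
              (\<forall>x\<in>topspace (top_of_set X). h (0, x) = id x) \<and>
              (\<forall>x\<in>topspace (top_of_set X). h (1, x) = H (1, x)) \<and>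
              (\<forall>t\<in>{0..1}. (\<lambda>x. h (t, x)) \<in> R \<rightarrow> T)"
            using cont H(3) that(2) by (intro exI[of _ H]) auto
        qed
        then show ?thesis
          using homotopic_with_sym by blast
      qed
      have sub: "X - K' \<subseteq> N"
        by (auto simp: K'_def)
      show ?thesis
        unfolding S_def
      proof (intro conjI)
        show "K \<subseteq> K'"
          by (auto simp: K'_def)
        show "(\<lambda>x. H (1, x)) \<in> (X - K') \<rightarrow> A"
          using H(6) sub by blast
        show "homotopic_with (\<lambda>f. f \<in> A \<rightarrow> A) (top_of_set X) (top_of_set X) (\<lambda>x. H (1, x)) id"
          using H(4) A(3) by (intro htp) auto
        show "homotopic_with (\<lambda>f. f \<in> (X - K') \<rightarrow> (X - K)) (top_of_set X) (top_of_set X) (\<lambda>x. H (1, x)) id"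
          using H(5) sub by (intro htp) blast+
      qed
    qed
    ultimately show ?thesis by blast
  qed
  have "P 0 (B 0)"
    using B_cpt B_sub by (simp add: P_def)
  then obtain K where K: "\<And>n. P n (K n)" "\<And>n. \<exists>h. S (K n) (K (Suc n)) h"
    using dependent_nat_choice[of P "\<lambda>n K K'. \<exists>h. S K K' h"] step by blast
  then obtain h where h: "\<And>n. S (K n) (K (Suc n)) (h n)"
    by metis
  have "tame_pair (top_of_set X) A K h"
  proof
    show "Hausdorff_space (top_of_set X)"
      by (simp add: Hausdorff_space_subtopology)
    show "closedin (top_of_set X) A" by (rule clo)
    show "compactin (subtopology (top_of_set X) (topspace (top_of_set X) - A)) (K n)" for n
      unfolding cpt using K(1) by (simp add: P_def)
    show "\<exists>n. L \<subseteq> K n"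
      if L: "compactin (subtopology (top_of_set X) (topspace (top_of_set X) - A)) L" for L
    proof -
      obtain n where "L \<subseteq> B n"
        using B_exhaust L unfolding cpt by blast
      then show ?thesis
        using K(1)[of n] by (auto simp: P_def)
    qed
  qed (use h in \<open>simp_all add: S_def\<close>)
  then show ?thesis by blast
qed

section \<open>Diffeomorphisms acting on configurations\<close>

lemma continuous_on_diagonal_map:
  fixes f :: "'a::euclidean_space \<Rightarrow> 'a"
  assumes "continuous_on M f"
  shows "continuous_on (cart_power M) (diagonal_map f :: 'a^'k::finite \<Rightarrow> 'a^'k)"
  unfolding diagonal_map_def
  by (intro continuous_on_vec_lambda continuous_on_compose2[OF assms] continuous_intros)
    (auto simp: cart_power_def)

lemma homeomorphic_maps_diagonal_map:
  fixes f :: "'a::euclidean_space \<Rightarrow> 'a"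
  assumes fg: "homeomorphism M M f g"
  shows "homeomorphic_maps (top_of_set (cart_power M :: ('a^'k::finite) set)) (top_of_set (cart_power M))
    (diagonal_map f) (diagonal_map g)"
proof -
  have "continuous_on (cart_power M) (diagonal_map f :: 'a^'k \<Rightarrow> 'a^'k)"
    "continuous_on (cart_power M) (diagonal_map g :: 'a^'k \<Rightarrow> 'a^'k)"
    using fg continuous_on_diagonal_map by (auto simp: homeomorphism_def)
  moreover have "f x \<in> M" "g x \<in> M" "g (f x) = x" "f (g x) = x" if "x \<in> M" for x
    using fg that by (auto simp: homeomorphism_def)
  ultimately show ?thesis
    by (auto simp: homeomorphic_maps_def continuous_map_in_subtopology continuous_map_iff_continuous
        cart_power_def diagonal_map_def vec_eq_iff)
qed

lemma diagonal_map_preserves_loci: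
  assumes "f \<in> M \<rightarrow> M" "f p0 = p0"
  shows "diagonal_map f \<in> (fat_diagonal M \<union> basepoint_locus M p0 :: ('a^'k) set) \<rightarrow>
    fat_diagonal M \<union> basepoint_locus M p0"
proof (rule funcsetI)
  fix x :: "'a^'k" assume "x \<in> fat_diagonal M \<union> basepoint_locus M p0"
  then consider i j where "x \<in> cart_power M" "i \<noteq> j" "x $ i = x $ j"
    | i where "x \<in> cart_power M" "x $ i = p0"
    by (auto simp: fat_diagonal_def basepoint_locus_def)
  then show "diagonal_map f x \<in> fat_diagonal M \<union> basepoint_locus M p0"
  proof cases
    case 1
    then have "i \<noteq> j \<and> diagonal_map f x $ i = diagonal_map f x $ j" "diagonal_map f x \<in> cart_power M"
      using assms(1) by (auto simp: diagonal_map_def cart_power_def)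
    then have "diagonal_map f x \<in> fat_diagonal M"
      unfolding fat_diagonal_def by blast
    then show ?thesis by blast
  next
    case 2
    then have "diagonal_map f x $ i = p0" "diagonal_map f x \<in> cart_power M"
      using assms by (auto simp: diagonal_map_def cart_power_def)
    then have "diagonal_map f x \<in> basepoint_locus M p0"
      unfolding basepoint_locus_def by blast
    then show ?thesis by blast
  qed
qed

lemma Diff_bdryD:
  assumes "f \<in> carrier (Diff_bdry M)"
  shows "f \<in> Bij M" "homeomorphism M M f (inv_into M f)" "x \<in> bdry M \<Longrightarrow> f x = x"
  using assms diffeo_imp_homeomorphism by (auto simp: Diff_bdry_def)

lemma bdry_subset: "bdry M \<subseteq> M"
proof
  fix x assume "x \<in> bdry M"
  then obtain W \<phi> p where c: "chart M W \<phi>" "p \<in> W" "x = \<phi> p"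
    by (auto simp: bdry_def)
  then have "openin (top_of_set M) (\<phi> ` W)"
    by (simp add: chart_def)
  then have "\<phi> ` W \<subseteq> M"
    by (rule openin_imp_subset)
  then show "x \<in> M" using c by blast
qed

lemma mult_Diff_bdry:
  assumes "f \<in> carrier (Diff_bdry M)" "h \<in> carrier (Diff_bdry M)"
  shows "f \<otimes>\<^bsub>Diff_bdry M\<^esub> h = compose M f h"
  using Diff_bdryD(1)[OF assms(1)] Diff_bdryD(1)[OF assms(2)] by (simp add: Diff_bdry_def BijGroup_def)

lemma topspace_Cinf: "topspace (Cinf_topology M) \<subseteq> carrier (Diff_bdry M)"
  unfolding Cinf_topology_def topology_generated_by_topspace by blast

text \<open>The empty list of directions in the definition of the \<open>C\<^sup>\<infinity>\<close> topology controls the maps themselves,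
  uniformly on compact subsets of charts; together with continuity of a single map on the surface
  this gives joint continuity.\<close>

lemma path_in_Cinf_continuous:
  assumes M: "smooth_surface M" and path: "pathin (Cinf_topology M) c"
  shows "continuous_on ({0..1} \<times> M) (\<lambda>(t, y). c t y)"
  unfolding continuous_on_iff
proof (intro ballI allI impI)
  fix z :: "real \<times> 'a" and \<epsilon> :: real assume z: "z \<in> {0..1} \<times> M" and \<epsilon>: "0 < \<epsilon>"
  obtain t0 y0 where z_eq: "z = (t0, y0)" "t0 \<in> {0..1}" "y0 \<in> M"
    using z by (cases z) auto
  have c_diff: "c t \<in> carrier (Diff_bdry M)" if "t \<in> {0..1}" for t
    using path that topspace_Cinf unfolding pathin_def continuous_map_def by fastforce
  obtain W \<phi> p where W: "chart M W \<phi>" "p \<in> W" "y0 = \<phi> p"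
    using M z_eq(3) unfolding smooth_surface_def by blast
  have opW: "openin (top_of_set half_plane) W" and op_im: "openin (top_of_set M) (\<phi> ` W)"
    using W(1) by (auto simp: chart_def)
  have W_sub: "W \<subseteq> half_plane" "\<phi> ` W \<subseteq> M"
    by (rule openin_imp_subset[OF opW], rule openin_imp_subset[OF op_im])
  obtain r where r: "r > 0" "\<And>q. \<lbrakk>q \<in> half_plane; dist q p < r\<rbrakk> \<Longrightarrow> q \<in> W"
    using opW W(2) unfolding openin_euclidean_subtopology_iff by blast
  define K where "K = cball p (r/2) \<inter> half_plane"
  have "closed half_plane"
    unfolding half_plane_def by (intro closed_Collect_le continuous_intros)
  then have K: "compact K" "K \<subseteq> W"
    using r by (auto simp: K_def dist_commute)
  have hom: "homeomorphism W (\<phi> ` W) \<phi> (inv_into W \<phi>)"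
    using chart_imp_homeomorphism[OF W(1)] .
  have "openin (top_of_set half_plane) (ball p (r/2) \<inter> half_plane)"
    by (simp add: openin_open_Int Int_commute)
  moreover have sub: "ball p (r/2) \<inter> half_plane \<subseteq> K"
    by (auto simp: K_def)
  ultimately have "openin (top_of_set W) (ball p (r/2) \<inter> half_plane)"
    using K(2) W_sub(1) by (auto intro: openin_subset_trans)
  then have "openin (top_of_set (\<phi> ` W)) (\<phi> ` (ball p (r/2) \<inter> half_plane))"
    using homeomorphism_imp_open_map[OF hom] by blast
  then have opN: "openin (top_of_set M) (\<phi> ` (ball p (r/2) \<inter> half_plane))"
    using op_im openin_trans by blast
  have "y0 \<in> \<phi> ` (ball p (r/2) \<inter> half_plane)"
    using W r(1) W_sub(1) by auto
  then obtain \<delta>1 where \<delta>1: "\<delta>1 > 0"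
    "\<And>y. \<lbrakk>y \<in> M; dist y y0 < \<delta>1\<rbrakk> \<Longrightarrow> y \<in> \<phi> ` (ball p (r/2) \<inter> half_plane)"
    using opN unfolding openin_euclidean_subtopology_iff by blast
  have "continuous_on M (c t0)"
    using Diff_bdryD(2)[OF c_diff[OF z_eq(2)]] by (simp add: homeomorphism_def)
  then obtain \<delta>2 where \<delta>2: "\<delta>2 > 0"
    "\<And>y. \<lbrakk>y \<in> M; dist y y0 < \<delta>2\<rbrakk> \<Longrightarrow> dist (c t0 y) (c t0 y0) < \<epsilon> / 2"
    using z_eq(3) \<epsilon> unfolding continuous_on_iff by (metis half_gt_zero)
  define N where "N = {h \<in> carrier (Diff_bdry M).
      \<forall>q\<in>K. norm (deriv_along [] (h \<circ> \<phi>) q - deriv_along [] (c t0 \<circ> \<phi>) q) < \<epsilon> / 2}"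
  have "openin (Cinf_topology M) N"
    unfolding Cinf_topology_def
    by (rule topology_generated_by_Basis) (use N_def c_diff[OF z_eq(2)] W(1) K \<epsilon> half_gt_zero in blast)
  then have "openin (top_of_set {0..1}) {t \<in> {0..1}. c t \<in> N}"
    using path unfolding pathin_def continuous_map_def by auto
  moreover have "t0 \<in> {t \<in> {0..1}. c t \<in> N}"
    using z_eq(2) c_diff \<epsilon> by (auto simp: N_def)
  ultimately obtain \<delta>3 where \<delta>3: "\<delta>3 > 0" "\<And>t. \<lbrakk>t \<in> {0..1}; dist t t0 < \<delta>3\<rbrakk> \<Longrightarrow> c t \<in> N"
    unfolding openin_euclidean_subtopology_iff by blast
  define \<delta> where "\<delta> = min \<delta>1 (min \<delta>2 \<delta>3)"
  show "\<exists>d>0. \<forall>x'\<in>{0..1} \<times> M. dist x' z < d \<longrightarrow>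
      dist (case x' of (t, y) \<Rightarrow> c t y) (case z of (t, y) \<Rightarrow> c t y) < \<epsilon>"
  proof (intro exI conjI ballI impI)
    show "\<delta> > 0" using \<delta>1 \<delta>2 \<delta>3 by (simp add: \<delta>_def)
    fix x' assume x': "x' \<in> {0..1} \<times> M" "dist x' z < \<delta>"
    obtain t y where x'_eq: "x' = (t, y)" "t \<in> {0..1}" "y \<in> M"
      using x'(1) by (cases x') auto
    have "dist t t0 < \<delta>" "dist y y0 < \<delta>"
      using x'(2) dist_fst_le[of x' z] dist_snd_le[of x' z] by (auto simp: x'_eq z_eq)
    then have d: "dist t t0 < \<delta>3" "dist y y0 < \<delta>1" "dist y y0 < \<delta>2"
      by (simp_all add: \<delta>_def)
    have ty: "c t \<in> N" "dist (c t0 y) (c t0 y0) < \<epsilon> / 2" "y \<in> \<phi> ` K"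
      using \<delta>3(2)[OF x'_eq(2) d(1)] \<delta>2(2)[OF x'_eq(3) d(3)] \<delta>1(2)[OF x'_eq(3) d(2)] sub by blast+
    then have "dist (c t y) (c t0 y) < \<epsilon> / 2"
      by (auto simp: N_def dist_norm)
    then have "dist (c t y) (c t0 y0) < \<epsilon>"
      using ty(2) dist_triangle[of "c t y" "c t0 y0" "c t0 y"] by simp
    then show "dist (case x' of (t, y) \<Rightarrow> c t y) (case z of (t, y) \<Rightarrow> c t y) < \<epsilon>"
      by (simp add: x'_eq z_eq)
  qed
qed

lemma isotopic_imp_homotopic_diagonal_maps:
  fixes M :: "'a::euclidean_space set" and p0 :: 'a
  assumes M: "smooth_surface M" and p0: "p0 \<in> bdry M"
    and path: "path_component_of (Cinf_topology M) f h"
  defines "X \<equiv> top_of_set (cart_power M :: ('a^'k::finite) set)"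
    and "A \<equiv> fat_diagonal M \<union> basepoint_locus M p0 :: ('a^'k) set"
  shows "homotopic_with (\<lambda>u. u \<in> A \<rightarrow> A) X X (diagonal_map f) (diagonal_map h)"
proof -
  obtain c where c: "pathin (Cinf_topology M) c" "c 0 = f" "c 1 = h"
    using path by (auto simp: path_component_of_def)
  have c_diff: "c t \<in> carrier (Diff_bdry M)" if "t \<in> {0..1}" for t
    using c(1) that topspace_Cinf unfolding pathin_def continuous_map_def by fastforce
  have c_M: "c t \<in> M \<rightarrow> M" if "t \<in> {0..1}" for t
    using Diff_bdryD(2)[OF c_diff[OF that]] by (auto simp: homeomorphism_def)
  have "continuous_on ({0..1} \<times> cart_power M) (\<lambda>z. case (fst z, snd z $ i) of (t, y) \<Rightarrow> c t y)" for i :: 'k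
    by (rule continuous_on_compose2[OF path_in_Cinf_continuous[OF M c(1)]])
      (auto simp: cart_power_def intro!: continuous_intros)
  then have "continuous_on ({0..1} \<times> cart_power M) (\<lambda>z. diagonal_map (c (fst z)) (snd z) :: 'a^'k)"
    unfolding diagonal_map_def by (intro continuous_on_vec_lambda) auto
  moreover have "diagonal_map (c (fst z)) (snd z) \<in> cart_power M"
    if "z \<in> {0..1} \<times> cart_power M" for z :: "real \<times> ('a^'k)"
    using c_M that by (force simp: cart_power_def diagonal_map_def)
  ultimately have "continuous_map (prod_topology (top_of_set {0..1}) X) X
      (\<lambda>z. diagonal_map (c (fst z)) (snd z))"
    by (auto simp: X_def prod_topology_subtopology_eu continuous_map_in_subtopology continuous_map_iff_continuous)
  moreover have "diagonal_map (c t) \<in> A \<rightarrow> A" if "t \<in> {0..1}" for t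
    unfolding A_def
    by (intro diagonal_map_preserves_loci c_M that Diff_bdryD(3)[OF c_diff[OF that] p0])
  ultimately show ?thesis
    unfolding homotopic_with_def
    by (intro exI[of _ "\<lambda>z. diagonal_map (c (fst z)) (snd z)"]) (simp add: c)
qed

section \<open>Representations of the mapping class group\<close>

lemma carrier_mapping_class_groupD:
  assumes "\<gamma> \<in> carrier (mapping_class_group M)"
  shows "\<gamma> \<noteq> {}" "\<gamma> \<subseteq> carrier (Diff_bdry M)"
    and "\<lbrakk>f \<in> \<gamma>; h \<in> \<gamma>\<rbrakk> \<Longrightarrow> path_component_of (Cinf_topology M) f h"
proof -
  have \<gamma>: "\<gamma> \<in> path_components_of (Cinf_topology M)"
    using assms by (simp add: mapping_class_group_def)
  then show "\<gamma> \<noteq> {}"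
    using nonempty_path_components_of by blast
  show "\<gamma> \<subseteq> carrier (Diff_bdry M)"
    using path_components_of_subset[OF \<gamma>] topspace_Cinf by blast
  obtain x where "\<gamma> = path_component_of_set (Cinf_topology M) x"
    using \<gamma> by (auto simp: path_components_of_def)
  then show "path_component_of (Cinf_topology M) f h" if "f \<in> \<gamma>" "h \<in> \<gamma>"
    using that by (metis mem_Collect_eq path_component_of_sym path_component_of_trans)
qed

text \<open>All products of members of \<open>\<gamma>\<close> and \<open>\<delta>\<close> act in the same way, so any element of \<open>\<gamma> \<otimes> \<delta>\<close> can be used to
  evaluate the representation there.\<close>

lemma mcg_representation_of_action:
  assumes A: "comm_group A"
    and auto: "\<And>f. f \<in> carrier (Diff_bdry M) \<Longrightarrow> act f \<in> auto A"
    and comp: "\<And>f h. \<lbrakk>f \<in> carrier (Diff_bdry M); h \<in> carrier (Diff_bdry M)\<rbrakk>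
        \<Longrightarrow> act (compose M f h) = compose (carrier A) (act f) (act h)"
    and iso: "\<And>f h. path_component_of (Cinf_topology M) f h \<Longrightarrow> act f = act h"
  shows "mcg_representation M A act (\<lambda>\<gamma>. act (SOME f. f \<in> \<gamma>))"
proof -
  have act: "act (SOME f. f \<in> \<gamma>) = act f" if "\<gamma> \<in> carrier (mapping_class_group M)" "f \<in> \<gamma>" for \<gamma> f
    using carrier_mapping_class_groupD(3)[OF that(1) someI[of "\<lambda>f. f \<in> \<gamma>", OF that(2)] that(2)] iso by blast
  have "(\<lambda>\<gamma>. act (SOME f. f \<in> \<gamma>)) \<in> hom (mapping_class_group M) (AutoGroup A)"
  proof (rule homI)
    fix \<gamma> assume \<gamma>: "\<gamma> \<in> carrier (mapping_class_group M)"
    then obtain f where f: "f \<in> \<gamma>"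
      using carrier_mapping_class_groupD(1) by blast
    then have "act f \<in> auto A"
      using carrier_mapping_class_groupD(2)[OF \<gamma>] auto by blast
    then show "act (SOME f. f \<in> \<gamma>) \<in> carrier (AutoGroup A)"
      using act[OF \<gamma> f] by (simp add: AutoGroup_def)
  next
    fix \<gamma> \<delta> assume \<gamma>: "\<gamma> \<in> carrier (mapping_class_group M)" and \<delta>: "\<delta> \<in> carrier (mapping_class_group M)"
    obtain f h where fh: "f \<in> \<gamma>" "h \<in> \<delta>"
      using carrier_mapping_class_groupD(1) \<gamma> \<delta> by blast
    have fh_diff: "f \<in> carrier (Diff_bdry M)" "h \<in> carrier (Diff_bdry M)"
      using carrier_mapping_class_groupD(2) \<gamma> \<delta> fh by blast+
    have prod: "\<gamma> \<otimes>\<^bsub>mapping_class_group M\<^esub> \<delta> = (\<Union>u\<in>\<gamma>. \<Union>v\<in>\<delta>. {u \<otimes>\<^bsub>Diff_bdry M\<^esub> v})"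
      by (simp add: mapping_class_group_def set_mult_def)
    have "act w = compose (carrier A) (act f) (act h)" if "w \<in> \<gamma> \<otimes>\<^bsub>mapping_class_group M\<^esub> \<delta>" for w
    proof -
      obtain u v where uv: "u \<in> \<gamma>" "v \<in> \<delta>" "w = u \<otimes>\<^bsub>Diff_bdry M\<^esub> v"
        using \<open>w \<in> _\<close> unfolding prod by blast
      then have "u \<in> carrier (Diff_bdry M)" "v \<in> carrier (Diff_bdry M)"
        using carrier_mapping_class_groupD(2) \<gamma> \<delta> by blast+
      then have "act w = compose (carrier A) (act u) (act v)"
        using comp uv(3) by (simp add: mult_Diff_bdry)
      then show ?thesis
        using act[OF \<gamma>] act[OF \<delta>] uv(1,2) fh by metis
    qed
    moreover have "f \<otimes>\<^bsub>Diff_bdry M\<^esub> h \<in> \<gamma> \<otimes>\<^bsub>mapping_class_group M\<^esub> \<delta>"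
      unfolding prod using fh by blast
    ultimately have "act (SOME w. w \<in> \<gamma> \<otimes>\<^bsub>mapping_class_group M\<^esub> \<delta>) = compose (carrier A) (act f) (act h)"
      by (metis someI)
    also have "\<dots> = act f \<otimes>\<^bsub>AutoGroup A\<^esub> act h"
      using auto[OF fh_diff(1)] auto[OF fh_diff(2)] by (simp add: AutoGroup_def BijGroup_def auto_def)
    finally show "act (SOME w. w \<in> \<gamma> \<otimes>\<^bsub>mapping_class_group M\<^esub> \<delta>) =
        act (SOME f. f \<in> \<gamma>) \<otimes>\<^bsub>AutoGroup A\<^esub> act (SOME f. f \<in> \<delta>)"
      using act[OF \<gamma> fh(1)] act[OF \<delta> fh(2)] by simp
  qed
  then show ?thesis
    using A act by (simp add: mcg_representation_def)
qed

section \<open>The two actions and their comparison\<close>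

text \<open>Equivariance makes \<open>a\<close> the conjugate of \<open>b\<close> by \<open>\<Phi>\<close>.\<close>

lemma auto_transport:
  assumes \<Phi>: "\<Phi> \<in> iso A B" and A: "group A" and b: "b \<in> auto B"
    and a: "a \<in> extensional (carrier A)" "\<And>x. x \<in> carrier A \<Longrightarrow> a x \<in> carrier A"
    and nat: "\<And>x. x \<in> carrier A \<Longrightarrow> \<Phi> (a x) = b (\<Phi> x)"
  shows "a \<in> auto A"
proof -
  interpret A: group A by (rule A)
  have inj: "inj_on \<Phi> (carrier A)" and surj: "\<Phi> ` carrier A = carrier B" and hom: "\<Phi> \<in> hom A B"
    using \<Phi> by (auto simp: iso_def bij_betw_def)
  have b_bij: "inj_on b (carrier B)" "b ` carrier B = carrier B" and b_hom: "b \<in> hom B B"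
    using b by (auto simp: auto_def Bij_def bij_betw_def)
  have \<Phi>_in: "\<Phi> x \<in> carrier B" if "x \<in> carrier A" for x
    using surj that by blast
  have "a \<in> hom A A"
  proof (rule homI)
    fix x y assume xy: "x \<in> carrier A" "y \<in> carrier A"
    have eq: "\<Phi> (a (x \<otimes>\<^bsub>A\<^esub> y)) = \<Phi> (a x \<otimes>\<^bsub>A\<^esub> a y)"
      using xy a(2) by (simp add: nat hom_mult[OF hom] hom_mult[OF b_hom] \<Phi>_in)
    show "a (x \<otimes>\<^bsub>A\<^esub> y) = a x \<otimes>\<^bsub>A\<^esub> a y"
      by (rule inj_onD[OF inj eq]) (simp_all add: xy a(2))
  qed (rule a(2))
  moreover have "inj_on a (carrier A)"
  proof (rule inj_onI)
    fix x y assume xy: "x \<in> carrier A" "y \<in> carrier A" and "a x = a y"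
    then have "b (\<Phi> x) = b (\<Phi> y)"
      using nat by metis
    from inj_onD[OF b_bij(1) this \<Phi>_in[OF xy(1)] \<Phi>_in[OF xy(2)]]
    show "x = y"
      by (rule inj_onD[OF inj _ xy])
  qed
  moreover have "carrier A \<subseteq> a ` carrier A"
  proof
    fix y assume y: "y \<in> carrier A"
    then obtain x where x: "x \<in> carrier A" "\<Phi> y = b (\<Phi> x)"
      using b_bij(2) surj \<Phi>_in by (metis imageE)
    then have "\<Phi> (a x) = \<Phi> y"
      using nat by simp
    then have "a x = y"
      by (rule inj_onD[OF inj]) (use x(1) y a(2) in auto)
    then show "y \<in> a ` carrier A"
      using x(1) by blast
  qed
  ultimately show ?thesis
    using a by (auto simp: auto_def Bij_def bij_betw_def)
qed

lemma restrict_iso_auto: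
  assumes \<psi>: "\<psi> \<in> iso G G" and G: "group G"
  shows "restrict \<psi> (carrier G) \<in> auto G"
proof -
  interpret group G by (rule G)
  have hom: "\<psi> \<in> hom G G" and bij: "bij_betw \<psi> (carrier G) (carrier G)"
    using \<psi> by (auto simp: iso_def)
  have "restrict \<psi> (carrier G) \<in> hom G G"
    using hom by (auto simp: hom_def)
  moreover have "bij_betw (restrict \<psi> (carrier G)) (carrier G) (carrier G)"
    using bij by (simp cong: bij_betw_cong)
  ultimately show ?thesis
    by (simp add: auto_def Bij_def)
qed

lemma based_homeomorphism_diagonal_map:
  fixes M :: "'a::euclidean_space set"
  assumes hom: "homeomorphism M M f g" and p0: "p0 \<in> M" "f p0 = p0"
  defines "X \<equiv> top_of_set (cart_power M :: ('a^'k::finite) set)"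
    and "A \<equiv> fat_diagonal M \<union> basepoint_locus M p0 :: ('a^'k) set"
  shows "homeomorphic_maps X X (diagonal_map f) (diagonal_map g)"
    and "diagonal_map f \<in> A \<rightarrow> A" "diagonal_map g \<in> A \<rightarrow> A"
proof -
  show "homeomorphic_maps X X (diagonal_map f) (diagonal_map g)"
    unfolding X_def using homeomorphic_maps_diagonal_map[OF hom] .
  have "f \<in> M \<rightarrow> M" "g \<in> M \<rightarrow> M" "g p0 = p0"
    using hom p0 by (auto simp: homeomorphism_def)
  from diagonal_map_preserves_loci[OF this(1) p0(2)] diagonal_map_preserves_loci[OF this(2,3)]
  show "diagonal_map f \<in> A \<rightarrow> A" "diagonal_map g \<in> A \<rightarrow> A"
    unfolding A_def .
qed

lemma Diff_bdry_based_homeomorphism: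
  assumes "f \<in> carrier (Diff_bdry M)" "p0 \<in> bdry M"
  shows "homeomorphism M M f (inv_into M f)" "p0 \<in> M" "f p0 = p0"
  using Diff_bdryD[OF assms(1)] assms(2) bdry_subset by blast+

lemma Moriyama_action_auto:
  fixes M :: "'a::euclidean_space set"
  assumes f: "f \<in> carrier (Diff_bdry M)" and p0: "p0 \<in> bdry M"
  shows "(Moriyama_action M p0 f :: ('a^'k::finite) chain set \<Rightarrow> _) \<in> auto (Moriyama_module M p0)"
proof -
  define X where "X = top_of_set (cart_power M :: ('a^'k) set)"
  define A where "A = (fat_diagonal M \<union> basepoint_locus M p0 :: ('a^'k) set)"
  note based = based_homeomorphism_diagonal_map[OF Diff_bdry_based_homeomorphism[OF f p0],
      where 'k = 'k, folded X_def A_def]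
  have "hom_induced (int CARD('k)) X A X A (diagonal_map f)
      \<in> iso (relative_homology_group (int CARD('k)) X A) (relative_homology_group (int CARD('k)) X A)"
    using homeomorphic_maps_relative_homology_group_isomorphisms[OF based]
    by (rule group_isomorphisms_imp_iso)
  from restrict_iso_auto[OF this group_relative_homology_group] show ?thesis
    by (simp add: Moriyama_action_def Moriyama_module_def X_def A_def)
qed

lemma Moriyama_action_compose:
  fixes M :: "'a::euclidean_space set"
  assumes f: "f \<in> carrier (Diff_bdry M)" and h: "h \<in> carrier (Diff_bdry M)" and p0: "p0 \<in> bdry M"
  shows "(Moriyama_action M p0 (compose M f h) :: ('a^'k::finite) chain set \<Rightarrow> _) =
    compose (carrier (Moriyama_module M p0)) (Moriyama_action M p0 f) (Moriyama_action M p0 h)"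
proof -
  define X where "X = top_of_set (cart_power M :: ('a^'k) set)"
  define A where "A = (fat_diagonal M \<union> basepoint_locus M p0 :: ('a^'k) set)"
  have cont: "continuous_map X X (diagonal_map u)" and loci: "diagonal_map u \<in> A \<rightarrow> A"
    if "u \<in> carrier (Diff_bdry M)" for u
    using based_homeomorphism_diagonal_map[OF Diff_bdry_based_homeomorphism[OF that p0], where 'k = 'k]
    by (simp_all add: homeomorphic_maps_def X_def A_def)
  have "hom_induced (int CARD('k)) X A X A (diagonal_map (compose M f h)) =
      hom_induced (int CARD('k)) X A X A (diagonal_map f \<circ> diagonal_map h)"
    by (rule hom_induced_eq) (auto simp: X_def diagonal_map_def cart_power_def compose_def)
  also have "\<dots> = hom_induced (int CARD('k)) X A X A (diagonal_map f) \<circ>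
      hom_induced (int CARD('k)) X A X A (diagonal_map h)"
    by (rule hom_induced_compose) (use cont loci f h in auto)
  finally show ?thesis
    by (intro ext) (simp add: Moriyama_action_def Moriyama_module_def compose_def restrict_def
        hom_induced_carrier flip: X_def A_def)
qed

lemma Moriyama_action_isotopy:
  fixes M :: "'a::euclidean_space set"
  assumes "smooth_surface M" "p0 \<in> bdry M" "path_component_of (Cinf_topology M) f h"
  shows "(Moriyama_action M p0 f :: ('a^'k::finite) chain set \<Rightarrow> _) = Moriyama_action M p0 h"
  using homology_homotopy_axiom[OF isotopic_imp_homotopic_diagonal_maps[OF assms, where 'k = 'k]]
  by (simp add: Moriyama_action_def)

lemma config_space_eq:
  "config_space (M - {p0}) = cart_power M - (fat_diagonal M \<union> basepoint_locus M p0)"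
  by (auto simp: config_space_def cart_power_def fat_diagonal_def basepoint_locus_def)

theorem theorem6:
  fixes \<Sigma> :: "('a::euclidean_space) set" and p0 :: 'a and g :: nat
  assumes "is_Sigma_g1 g \<Sigma>"
    and "p0 \<in> bdry \<Sigma>"
  shows "\<exists>\<rho>\<^sub>B\<^sub>M \<rho>\<^sub>M.
    mcg_representation \<Sigma> (BM_module \<Sigma> p0 :: ('a^'k::finite) lf_chain set monoid)
      (BM_action \<Sigma> p0) \<rho>\<^sub>B\<^sub>M \<and>
    mcg_representation \<Sigma> (Moriyama_module \<Sigma> p0 :: ('a^'k) chain set monoid)
      (Moriyama_action \<Sigma> p0) \<rho>\<^sub>M \<and>
    isomorphic_representations (mapping_class_group \<Sigma>)
      (BM_module \<Sigma> p0) \<rho>\<^sub>B\<^sub>M (Moriyama_module \<Sigma> p0) \<rho>\<^sub>M"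
proof -
  have surface: "smooth_surface \<Sigma>" and cpt: "compact \<Sigma>"
    using assms(1) by (auto simp: is_Sigma_g1_def)
  have p0: "p0 \<in> bdry \<Sigma>" "p0 \<in> \<Sigma>"
    using assms(2) bdry_subset by auto
  define X where "X = (cart_power \<Sigma> :: ('a^'k) set)"
  define A where "A = (fat_diagonal \<Sigma> \<union> basepoint_locus \<Sigma> p0 :: ('a^'k) set)"
  define BM where "BM = (BM_module \<Sigma> p0 :: ('a^'k) lf_chain set monoid)"
  define Mo where "Mo = (Moriyama_module \<Sigma> p0 :: ('a^'k) chain set monoid)"
  define \<Phi> where "\<Phi> = comparison CARD('k) (top_of_set X) A"
  have anr: "ANR \<Sigma>"
    using compact_surface_imp_ANR[OF surface cpt] .
  have "(\<chi> i. p0) \<in> A"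
    using p0(2) by (simp add: A_def basepoint_locus_def cart_power_def)
  moreover have "A \<subseteq> X"
    by (auto simp: A_def X_def fat_diagonal_def basepoint_locus_def)
  ultimately obtain K h where "tame_pair (top_of_set X) A K h"
    using tame_pair_exists[of X A] ANR_cart_power[OF anr] compact_cart_power[OF cpt]
      fat_diagonal_Un_basepoint_locus[OF anr cpt p0(2)]
    unfolding X_def A_def by blast
  then interpret tame_pair "top_of_set X" A K h .
  have U_eq: "top_of_set (config_space (\<Sigma> - {p0})) = U"
    by (simp add: config_space_eq X_def A_def subtopology_subtopology Int_absorb1)
  have BM_eq: "BM = BM_homology_group CARD('k) U" and Mo_eq: "Mo = relative_homology_group (int CARD('k)) (top_of_set X) A"
    by (simp_all only: BM_def Mo_def BM_module_def Moriyama_module_def U_eq X_def A_def)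
  have \<Phi>: "\<Phi> \<in> iso BM Mo"
    unfolding BM_eq Mo_eq \<Phi>_def by (rule comparison_iso)
  have BM_group: "comm_group BM"
    unfolding BM_eq by (rule comm_group_BM_homology_group)
  have Mo_group: "comm_group Mo"
    unfolding Mo_eq by simp
  have nat: "BM_action \<Sigma> p0 f S \<in> carrier BM" "\<Phi> (BM_action \<Sigma> p0 f S) = Moriyama_action \<Sigma> p0 f (\<Phi> S)"
    if hom: "homeomorphism \<Sigma> \<Sigma> f g" "p0 \<in> \<Sigma>" "f p0 = p0" and S: "S \<in> carrier BM" for f g S
  proof -
    note based = based_homeomorphism_diagonal_map[OF hom, where 'k = 'k, folded X_def A_def]
    have act: "BM_action \<Sigma> p0 f S = BM_induced CARD('k) U (diagonal_map f) S"
      using S unfolding BM_action_def BM_def by (simp add: U_eq)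
    show "BM_action \<Sigma> p0 f S \<in> carrier BM"
      unfolding act BM_eq by (rule comparison_natural(1)[OF based]) (use S BM_eq in simp)
    have "\<Phi> S \<in> carrier Mo"
      using \<Phi> S by (auto simp: iso_def hom_def)
    then show "\<Phi> (BM_action \<Sigma> p0 f S) = Moriyama_action \<Sigma> p0 f (\<Phi> S)"
      using comparison_natural(2)[OF based, of S "CARD('k)"] S
      by (simp add: act \<Phi>_def BM_eq Moriyama_action_def flip: X_def A_def Mo_def)
  qed
  have nat_diff: "BM_action \<Sigma> p0 f S \<in> carrier BM"
      "\<Phi> (BM_action \<Sigma> p0 f S) = Moriyama_action \<Sigma> p0 f (\<Phi> S)"
    if "f \<in> carrier (Diff_bdry \<Sigma>)" "S \<in> carrier BM" for f S
    by (rule nat[OF Diff_bdry_based_homeomorphism[OF that(1) p0(1)] that(2)])+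
  have ext: "BM_action \<Sigma> p0 f \<in> extensional (carrier BM)" for f
    by (simp add: BM_action_def BM_def)
  have inj: "inj_on \<Phi> (carrier BM)"
    using \<Phi> by (simp add: iso_def bij_betw_def)
  have eqI: "u = v" if "u \<in> extensional (carrier BM)" "v \<in> extensional (carrier BM)"
    "\<And>S. S \<in> carrier BM \<Longrightarrow> u S \<in> carrier BM \<and> v S \<in> carrier BM \<and> \<Phi> (u S) = \<Phi> (v S)" for u v
    by (rule extensionalityI[OF that(1,2)]) (use that(3) inj_onD[OF inj] in blast)
  have \<Phi>_in: "\<Phi> S \<in> carrier Mo" if "S \<in> carrier BM" for S
    using \<Phi> that by (auto simp: iso_def hom_def)
  define \<rho>M where "\<rho>M \<gamma> = (Moriyama_action \<Sigma> p0 (SOME f. f \<in> \<gamma>) :: ('a^'k) chain set \<Rightarrow> _)" for \<gamma>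
  define \<rho>B where "\<rho>B \<gamma> = (BM_action \<Sigma> p0 (SOME f. f \<in> \<gamma>) :: ('a^'k) lf_chain set \<Rightarrow> _)" for \<gamma>
  have repM: "mcg_representation \<Sigma> Mo (Moriyama_action \<Sigma> p0) \<rho>M"
    unfolding \<rho>M_def
    by (rule mcg_representation_of_action[OF Mo_group])
      (use Moriyama_action_auto Moriyama_action_compose Moriyama_action_isotopy surface p0(1) in
        \<open>auto simp: Mo_def\<close>)
  have repB: "mcg_representation \<Sigma> BM (BM_action \<Sigma> p0) \<rho>B"
    unfolding \<rho>B_def
  proof (rule mcg_representation_of_action[OF BM_group])
    fix f assume f: "f \<in> carrier (Diff_bdry \<Sigma>)"
    show "BM_action \<Sigma> p0 f \<in> auto BM"
    proof (rule auto_transport[OF \<Phi>])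
      show "group BM"
        using BM_group by (simp add: comm_group_def)
      show "Moriyama_action \<Sigma> p0 f \<in> auto Mo"
        unfolding Mo_def by (rule Moriyama_action_auto[OF f p0(1)])
    qed (use ext nat_diff f in auto)
  next
    fix f u assume f: "f \<in> carrier (Diff_bdry \<Sigma>)" and u: "u \<in> carrier (Diff_bdry \<Sigma>)"
    note fD = Diff_bdry_based_homeomorphism[OF f p0(1)] and uD = Diff_bdry_based_homeomorphism[OF u p0(1)]
    \<comment> \<open>Naturality is applied to the composite as a homeomorphism, which avoids differentiating it.\<close>
    have fu: "homeomorphism \<Sigma> \<Sigma> (compose \<Sigma> f u) (inv_into \<Sigma> u \<circ> inv_into \<Sigma> f)"
      using homeomorphism_compose[OF uD(1) fD(1)] by (rule homeomorphism_cong) (auto simp: compose_def)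
    have fu_p0: "compose \<Sigma> f u p0 = p0"
      using fD uD by (simp add: compose_def)
    note nat_fu = nat[OF fu p0(2) fu_p0]
    show "BM_action \<Sigma> p0 (compose \<Sigma> f u) = compose (carrier BM) (BM_action \<Sigma> p0 f) (BM_action \<Sigma> p0 u)"
    proof (rule eqI)
      fix S assume S: "S \<in> carrier BM"
      have "\<Phi> (BM_action \<Sigma> p0 (compose \<Sigma> f u) S) =
          Moriyama_action \<Sigma> p0 f (Moriyama_action \<Sigma> p0 u (\<Phi> S))"
        using nat_fu(2)[OF S] Moriyama_action_compose[OF f u p0(1), where 'k = 'k] \<Phi>_in[OF S]
        by (simp add: compose_eq Mo_def)
      also have "\<dots> = \<Phi> (BM_action \<Sigma> p0 f (BM_action \<Sigma> p0 u S))"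
        using nat_diff[OF u S] nat_diff(2)[OF f] by simp
      finally show "BM_action \<Sigma> p0 (compose \<Sigma> f u) S \<in> carrier BM \<and>
          compose (carrier BM) (BM_action \<Sigma> p0 f) (BM_action \<Sigma> p0 u) S \<in> carrier BM \<and>
          \<Phi> (BM_action \<Sigma> p0 (compose \<Sigma> f u) S) =
          \<Phi> (compose (carrier BM) (BM_action \<Sigma> p0 f) (BM_action \<Sigma> p0 u) S)"
        using nat_diff(1) nat_fu(1)[OF S] f u S by (simp add: compose_eq)
    qed (use ext in auto)
  next
    fix f u assume path: "path_component_of (Cinf_topology \<Sigma>) f u"
    then have f: "f \<in> carrier (Diff_bdry \<Sigma>)" and u: "u \<in> carrier (Diff_bdry \<Sigma>)"
      using path_component_in_topspace[OF path] topspace_Cinf by auto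
    show "(BM_action \<Sigma> p0 f :: ('a^'k) lf_chain set \<Rightarrow> _) = BM_action \<Sigma> p0 u"
    proof (rule eqI[OF ext ext])
      fix S assume S: "S \<in> carrier BM"
      show "BM_action \<Sigma> p0 f S \<in> carrier BM \<and> BM_action \<Sigma> p0 u S \<in> carrier BM \<and>
          \<Phi> (BM_action \<Sigma> p0 f S) = \<Phi> (BM_action \<Sigma> p0 u S)"
        using nat_diff[OF f S] nat_diff[OF u S]
          Moriyama_action_isotopy[OF surface p0(1) path, where 'k = 'k] by simp
    qed
  qed
  have "\<Phi> (\<rho>B \<gamma> S) = \<rho>M \<gamma> (\<Phi> S)" if \<gamma>: "\<gamma> \<in> carrier (mapping_class_group \<Sigma>)" and S: "S \<in> carrier BM" for \<gamma> S
  proof -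
    have "(SOME f. f \<in> \<gamma>) \<in> \<gamma>"
      using carrier_mapping_class_groupD(1)[OF \<gamma>] by (simp add: some_in_eq)
    then show ?thesis
      using nat_diff(2)[OF _ S] carrier_mapping_class_groupD(2)[OF \<gamma>] by (auto simp: \<rho>B_def \<rho>M_def)
  qed
  then have "isomorphic_representations (mapping_class_group \<Sigma>) BM \<rho>B Mo \<rho>M"
    unfolding isomorphic_representations_def using \<Phi> by blast
  then show ?thesis
    using repB repM unfolding BM_def Mo_def by blast
qed

end
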